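(* Let $\mathcal A\subseteq B(\mathcal H)$ be a von Neumann algebra and let $\tau:\mathcal A\to\mathcal A$ be a normal unital completely positive map. Let $(\mathcal K,\mathcal B,\theta)$ be the minimal dilation of $\tau$ and let $p$ be the orthogonal projection of $\mathcal K$ onto $\mathcal H$. Let $T$ denote the compression map $z\mapsto pzp$ restricted to $\mathcal P(\theta)$. Then the completely positive map $T$ maps the $C^*$-algebra $\mathcal P(\theta)$ isometrically and bijectively onto $\mathcal P(\tau)$. In particular, setting $$x\circ y := T\big(T^{-1}(x)\,T^{-1}(y)\big),\qquad x,y\in\mathcal P(\tau),$$ makes $(\mathcal P(\tau),\circ)$ (with the norm and involution inherited from $\mathcal A$) a unital $C^*$-algebra. Moreover, $T$ is a complete isometry.
   Context: All Hilbert spaces are complex and separable; $\mathbb T=\{z\in\mathbb C:|z|=1\}$. For Hilbert spaces $\mathcal H\subseteq\mathcal K$ with $p$ the orthogonal projection of $\mathcal K$ onto $\mathcal H$, an operator $x\in B(\mathcal H)$ is identified with $pxp\in B(\mathcal K)$ (i.e. extended by $0$ on $\mathcal H^\perp$). Minimal dilation: it is known that for every normal unital completely positive map $\tau$ on a von Neumann algebra $\mathcal A\subseteq B(\mathcal H)$ there is a triple $(\mathcal K,\mathcal B,\theta)$, unique up to unitary equivalence fixing $\mathcal H$ pointwise, such that: $\mathcal K\supseteq\mathcal H$ is a Hilbert space containing $\mathcal H$ as a closed subspace; $\mathcal B\subseteq B(\mathcal K)$ is a von Neumann algebra with $\mathcal A=p\mathcal Bp$ (so $p$ is the identity of $\mathcal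 A$); $\theta:\mathcal B\to\mathcal B$ is a normal unital $*$-endomorphism; $\tau^n(x)=p\theta^n(x)p$ for all $x\in\mathcal A$, $n\in\mathbb Z_+$; $\mathcal K$ is the closed linear span of $\{\theta^n(x_n)\theta^{n-1}(x_{n-1})\cdots\theta(x_1)h: x_1,\dots,x_n\in\mathcal A,\ h\in\mathcal H,\ n\in\mathbb Z_+\}$; and $\mathcal B$ is the von Neumann algebra generated by $\{\theta^n(x):n\in\mathbb Z_+,x\in\mathcal A\}$. This triple is called the minimal dilation of $\tau$. $\mathcal P(\tau)$ is the operator norm closure of $E(\tau)=\mathrm{span}\{x\in\mathcal A:\tau(x)=\lambda x\text{ for some }\lambda\in\mathbb T\}$, and $\mathcal P(\theta)$ is the operator norm closure of $E(\theta)=\mathrm{span}\{x\in\mathcal B:\theta(x)=\lambda x\text{ for some }\lambda\in\mathbb T\}$. Since $\theta$ is a $*$-endomorphism, $\mathcal P(\theta)$ is a unital $C^*$-subalgebra of $\mathcal B$. *)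

theory Defs
  imports "HOL-Analysis.Analysis"
begin

section \<open>Complex Hilbert spaces\<close>

class complex_normed_vector = real_normed_vector +
  fixes scaleC :: "complex \<Rightarrow> 'a \<Rightarrow> 'a"  (infixr \<open>*\<^sub>C\<close> 75)
  assumes scaleC_add_right: "a *\<^sub>C (x + y) = a *\<^sub>C x + a *\<^sub>C y"
    and scaleC_add_left: "(a + b) *\<^sub>C x = a *\<^sub>C x + b *\<^sub>C x"
    and scaleC_scaleC: "a *\<^sub>C (b *\<^sub>C x) = (a * b) *\<^sub>C x"
    and scaleC_of_real: "complex_of_real r *\<^sub>C x = r *\<^sub>R x"
    and norm_scaleC: "norm (a *\<^sub>C x) = cmod a * norm x"
begin

lemma scaleC_one: "1 *\<^sub>C x = x"
  using scaleC_of_real[of 1 x] by (simp add: scaleR_one)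

end

text \<open>The complex inner product is conjugate linear in its first argument.  Positive definiteness
  and the relation to the norm come from the real inner product, which is its real part.\<close>

class complex_hilbert_space = complex_normed_vector + real_inner + complete_space +
  fixes cinner :: "'a \<Rightarrow> 'a \<Rightarrow> complex"
  assumes cinner_commute: "cinner x y = cnj (cinner y x)"
    and cinner_add_right: "cinner x (y + z) = cinner x y + cinner x z"
    and cinner_scaleC_right: "cinner x (a *\<^sub>C y) = a * cinner x y"
    and Re_cinner: "Re (cinner x y) = x \<bullet> y"

global_interpretation complex_vector: vector_space "scaleC :: complex \<Rightarrow> 'a \<Rightarrow> 'a::complex_normed_vector"
  defines csubspace = complex_vector.subspace
    and cspan = complex_vector.span
  by unfold_locales (simp_all add: scaleC_add_right scaleC_add_left scaleC_scaleC scaleC_one)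


section \<open>Bounded operators\<close>

text \<open>The type of the library's bounded operators contains all real-linear ones; the bounded
  operators between complex Hilbert spaces are the members of \<open>bounded_ops\<close>.\<close>

definition bounded_ops :: "('a::complex_normed_vector \<Rightarrow>\<^sub>L 'b::complex_normed_vector) set" where
  "bounded_ops = {x. \<forall>c v. blinfun_apply x (c *\<^sub>C v) = c *\<^sub>C blinfun_apply x v}"

instantiation blinfun :: (real_normed_vector, complex_normed_vector) complex_normed_vector
begin

lift_definition scaleC_blinfun :: "complex \<Rightarrow> 'a \<Rightarrow>\<^sub>L 'b \<Rightarrow> 'a \<Rightarrow>\<^sub>L 'b" is "\<lambda>c f v. c *\<^sub>C f v"
proof -
  fix c :: complex and f :: "'a \<Rightarrow> 'b"
  assume f: "bounded_linear f"
  have "r *\<^sub>R (c *\<^sub>C x) = c *\<^sub>C (r *\<^sub>R x)" for r and x :: 'b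
    by (simp flip: scaleC_of_real add: scaleC_scaleC mult.commute)
  then have "bounded_linear (\<lambda>x::'b. c *\<^sub>C x)"
    by (intro bounded_linear_intro[where K = "cmod c"])
      (simp_all add: scaleC_add_right norm_scaleC mult.commute)
  then show "bounded_linear (\<lambda>v. c *\<^sub>C f v)"
    using f by (rule bounded_linear_compose)
qed

instance
proof
  fix a b :: complex and r :: real and x y :: "'a \<Rightarrow>\<^sub>L 'b"
  show "a *\<^sub>C (x + y) = a *\<^sub>C x + a *\<^sub>C y"
    by transfer (simp add: scaleC_add_right)
  show "(a + b) *\<^sub>C x = a *\<^sub>C x + b *\<^sub>C x"
    by transfer (simp add: scaleC_add_left)
  show "a *\<^sub>C b *\<^sub>C x = (a * b) *\<^sub>C x"
    by transfer (simp add: scaleC_scaleC)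
  show "complex_of_real r *\<^sub>C x = r *\<^sub>R x"
    by transfer (simp add: scaleC_of_real)
  show "norm (a *\<^sub>C x) = cmod a * norm x"
  proof transfer
    fix a :: complex and f :: "'a \<Rightarrow> 'b"
    assume f: "bounded_linear f"
    have "onorm (\<lambda>v. a *\<^sub>C f v) = onorm (\<lambda>v. cmod a *\<^sub>R f v)"
      by (simp add: onorm_def norm_scaleC)
    also have "\<dots> = cmod a * onorm f"
      using onorm_scaleR[OF f, of "cmod a"] by simp
    finally show "onorm (\<lambda>v. a *\<^sub>C f v) = cmod a * onorm f" .
  qed
qed

end

definition adj :: "('a::complex_hilbert_space \<Rightarrow>\<^sub>L 'b::complex_hilbert_space) \<Rightarrow> 'b \<Rightarrow>\<^sub>L 'a" where
  "adj x = (THE y. \<forall>u v. cinner (blinfun_apply x u) v = cinner u (blinfun_apply y v))"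

text \<open>The ultraweak (\<open>\<sigma>\<close>-weak) topology: the coarsest one making the functionals
  \<open>x \<mapsto> \<Sum>k. \<langle>u k, x (v k)\<rangle>\<close> with square-summable \<open>u\<close> and \<open>v\<close> continuous.\<close>

definition ultraweak_topology :: "('a::complex_hilbert_space \<Rightarrow>\<^sub>L 'a) topology" where
  "ultraweak_topology = topology_generated_by
     {{x. (\<Sum>k. cinner (u k) (blinfun_apply x (v k))) \<in> U} | (u :: nat \<Rightarrow> 'a) (v :: nat \<Rightarrow> 'a) U.
        summable (\<lambda>k. (norm (u k))\<^sup>2) \<and> summable (\<lambda>k. (norm (v k))\<^sup>2) \<and> open U}"

text \<open>The \<open>n \<times> n\<close> operator matrices are the functions of two indices below \<open>n\<close>, acting on the
  \<open>n\<close>-fold Hilbert sum.\<close>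

definition op_matrices :: "nat \<Rightarrow> 'a set \<Rightarrow> (nat \<Rightarrow> nat \<Rightarrow> 'a) set" where
  "op_matrices n S = {X. \<forall>i<n. \<forall>j<n. X i j \<in> S}"

definition op_matrix_pos :: "nat \<Rightarrow> (nat \<Rightarrow> nat \<Rightarrow> 'a::complex_hilbert_space \<Rightarrow>\<^sub>L 'a) \<Rightarrow> bool" where
  "op_matrix_pos n X \<longleftrightarrow>
     (\<forall>v. (\<Sum>i<n. cinner (v i) (\<Sum>j<n. blinfun_apply (X i j) (v j))) \<in> \<real>\<^sub>\<ge>\<^sub>0)"

definition op_matrix_norm :: "nat \<Rightarrow> (nat \<Rightarrow> nat \<Rightarrow> 'a::complex_hilbert_space \<Rightarrow>\<^sub>L 'a) \<Rightarrow> real" where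
  "op_matrix_norm n X =
     (SUP v \<in> {v. L2_set (\<lambda>j. norm (v j)) {..<n} \<le> 1}.
        L2_set (\<lambda>i. norm (\<Sum>j<n. blinfun_apply (X i j) (v j))) {..<n})"


section \<open>Operator algebras and maps between them\<close>

text \<open>The norm and the linear structure are those of the ambient space.\<close>

locale unital_cstar_algebra =
  fixes S :: "'a::complex_normed_vector set"
    and mult :: "'a \<Rightarrow> 'a \<Rightarrow> 'a"  (infixl \<open>\<odot>\<close> 70)
    and star :: "'a \<Rightarrow> 'a"
  assumes subspace: "csubspace S"
    and complete: "complete S"
    and mult_closed: "\<lbrakk>x \<in> S; y \<in> S\<rbrakk> \<Longrightarrow> x \<odot> y \<in> S"
    and mult_assoc: "\<lbrakk>x \<in> S; y \<in> S; z \<in> S\<rbrakk> \<Longrightarrow> (x \<odot> y) \<odot> z = x \<odot> (y \<odot> z)"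
    and mult_add_left: "\<lbrakk>x \<in> S; y \<in> S; z \<in> S\<rbrakk> \<Longrightarrow> (x + y) \<odot> z = x \<odot> z + y \<odot> z"
    and mult_add_right: "\<lbrakk>x \<in> S; y \<in> S; z \<in> S\<rbrakk> \<Longrightarrow> x \<odot> (y + z) = x \<odot> y + x \<odot> z"
    and mult_scaleC_left: "\<lbrakk>x \<in> S; y \<in> S\<rbrakk> \<Longrightarrow> (c *\<^sub>C x) \<odot> y = c *\<^sub>C (x \<odot> y)"
    and mult_scaleC_right: "\<lbrakk>x \<in> S; y \<in> S\<rbrakk> \<Longrightarrow> x \<odot> (c *\<^sub>C y) = c *\<^sub>C (x \<odot> y)"
    and unit: "\<exists>e\<in>S. \<forall>x\<in>S. e \<odot> x = x \<and> x \<odot> e = x"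
    and star_closed: "x \<in> S \<Longrightarrow> star x \<in> S"
    and star_star: "x \<in> S \<Longrightarrow> star (star x) = x"
    and star_add: "\<lbrakk>x \<in> S; y \<in> S\<rbrakk> \<Longrightarrow> star (x + y) = star x + star y"
    and star_scaleC: "x \<in> S \<Longrightarrow> star (c *\<^sub>C x) = cnj c *\<^sub>C star x"
    and star_mult: "\<lbrakk>x \<in> S; y \<in> S\<rbrakk> \<Longrightarrow> star (x \<odot> y) = star y \<odot> star x"
    and norm_mult_le: "\<lbrakk>x \<in> S; y \<in> S\<rbrakk> \<Longrightarrow> norm (x \<odot> y) \<le> norm x * norm y"
    and cstar_identity: "x \<in> S \<Longrightarrow> norm (star x \<odot> x) = (norm x)\<^sup>2"

definition von_neumann_algebra :: "('a::complex_hilbert_space \<Rightarrow>\<^sub>L 'a) set \<Rightarrow> bool" where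
  "von_neumann_algebra M \<longleftrightarrow>
     M \<subseteq> bounded_ops \<and> csubspace M \<and> id_blinfun \<in> M \<and>
     (\<forall>x\<in>M. \<forall>y\<in>M. x o\<^sub>L y \<in> M) \<and> (\<forall>x\<in>M. adj x \<in> M) \<and>
     closedin strong_operator_topology M"

definition generated_von_neumann_algebra ::
    "('a::complex_hilbert_space \<Rightarrow>\<^sub>L 'a) set \<Rightarrow> ('a \<Rightarrow>\<^sub>L 'a) set" where
  "generated_von_neumann_algebra S = \<Inter> {M. von_neumann_algebra M \<and> S \<subseteq> M}"

text \<open>Maps defined on a set of operators are total functions; their values outside it are
  irrelevant.\<close>

definition clinear_on :: "'a::complex_normed_vector set \<Rightarrow> ('a \<Rightarrow> 'b::complex_normed_vector) \<Rightarrow> bool" where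
  "clinear_on S f \<longleftrightarrow>
     (\<forall>x\<in>S. \<forall>y\<in>S. f (x + y) = f x + f y) \<and> (\<forall>c. \<forall>x\<in>S. f (c *\<^sub>C x) = c *\<^sub>C f x)"

definition completely_positive_on ::
    "('a::complex_hilbert_space \<Rightarrow>\<^sub>L 'a) set \<Rightarrow>
     ('a \<Rightarrow>\<^sub>L 'a \<Rightarrow> 'b::complex_hilbert_space \<Rightarrow>\<^sub>L 'b) \<Rightarrow> bool" where
  "completely_positive_on S f \<longleftrightarrow> clinear_on S f \<and>
     (\<forall>n. \<forall>X\<in>op_matrices n S. op_matrix_pos n X \<longrightarrow> op_matrix_pos n (\<lambda>i j. f (X i j)))"

definition completely_isometric_on ::
    "('a::complex_hilbert_space \<Rightarrow>\<^sub>L 'a) set \<Rightarrow>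
     ('a \<Rightarrow>\<^sub>L 'a \<Rightarrow> 'b::complex_hilbert_space \<Rightarrow>\<^sub>L 'b) \<Rightarrow> bool" where
  "completely_isometric_on S f \<longleftrightarrow> clinear_on S f \<and>
     (\<forall>n. \<forall>X\<in>op_matrices n S. op_matrix_norm n (\<lambda>i j. f (X i j)) = op_matrix_norm n X)"

definition normal_on ::
    "('a::complex_hilbert_space \<Rightarrow>\<^sub>L 'a) set \<Rightarrow> ('a \<Rightarrow>\<^sub>L 'a \<Rightarrow> 'a \<Rightarrow>\<^sub>L 'a) \<Rightarrow> bool" where
  "normal_on S f \<longleftrightarrow> continuous_map (subtopology ultraweak_topology S) ultraweak_topology f"

definition normal_ucp_map ::
    "('a::complex_hilbert_space \<Rightarrow>\<^sub>L 'a) set \<Rightarrow> ('a \<Rightarrow>\<^sub>L 'a \<Rightarrow> 'a \<Rightarrow>\<^sub>L 'a) \<Rightarrow> bool" where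
  "normal_ucp_map A \<tau> \<longleftrightarrow>
     \<tau> \<in> A \<rightarrow> A \<and> completely_positive_on A \<tau> \<and> \<tau> id_blinfun = id_blinfun \<and> normal_on A \<tau>"

definition normal_unital_star_endomorphism ::
    "('a::complex_hilbert_space \<Rightarrow>\<^sub>L 'a) set \<Rightarrow> ('a \<Rightarrow>\<^sub>L 'a \<Rightarrow> 'a \<Rightarrow>\<^sub>L 'a) \<Rightarrow> bool" where
  "normal_unital_star_endomorphism B \<theta> \<longleftrightarrow>
     \<theta> \<in> B \<rightarrow> B \<and> clinear_on B \<theta> \<and> (\<forall>x\<in>B. \<forall>y\<in>B. \<theta> (x o\<^sub>L y) = \<theta> x o\<^sub>L \<theta> y) \<and>
     (\<forall>x\<in>B. \<theta> (adj x) = adj (\<theta> x)) \<and> \<theta> id_blinfun = id_blinfun \<and> normal_on B \<theta>"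


section \<open>Minimal dilations\<close>

text \<open>The inclusion \<open>H \<subseteq> K\<close> of Hilbert spaces is given by an isometric embedding \<open>V\<close> of \<open>H\<close>
  into \<open>K\<close>.  Its range is a closed subspace, with orthogonal projection \<open>p = V V\<^sup>*\<close>, so
  \<open>extend_op V\<close> is the extension of an operator by zero on the orthogonal complement of \<open>H\<close>, and
  \<open>compress_op V z = V\<^sup>* z V\<close> is \<open>p z p\<close> regarded as an operator on \<open>H\<close>.\<close>

definition hilbert_embedding :: "('h::complex_hilbert_space \<Rightarrow>\<^sub>L 'k::complex_hilbert_space) \<Rightarrow> bool" where
  "hilbert_embedding V \<longleftrightarrow> V \<in> bounded_ops \<and> (\<forall>h. norm (blinfun_apply V h) = norm h)"

definition extend_op ::
    "('h::complex_hilbert_space \<Rightarrow>\<^sub>L 'k::complex_hilbert_space) \<Rightarrow> 'h \<Rightarrow>\<^sub>L 'h \<Rightarrow> 'k \<Rightarrow>\<^sub>L 'k" where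
  "extend_op V x = V o\<^sub>L x o\<^sub>L adj V"

definition compress_op ::
    "('h::complex_hilbert_space \<Rightarrow>\<^sub>L 'k::complex_hilbert_space) \<Rightarrow> 'k \<Rightarrow>\<^sub>L 'k \<Rightarrow> 'h \<Rightarrow>\<^sub>L 'h" where
  "compress_op V z = adj V o\<^sub>L z o\<^sub>L V"

text \<open>The vector \<open>\<theta>\<^sup>n(x\<^sub>n) \<cdots> \<theta>(x\<^sub>1) h\<close>; the value \<open>x 0\<close> is not used.\<close>

primrec dilation_vector ::
    "('h::complex_hilbert_space \<Rightarrow>\<^sub>L 'k::complex_hilbert_space) \<Rightarrow> ('k \<Rightarrow>\<^sub>L 'k \<Rightarrow> 'k \<Rightarrow>\<^sub>L 'k) \<Rightarrow>
     (nat \<Rightarrow> 'h \<Rightarrow>\<^sub>L 'h) \<Rightarrow> 'h \<Rightarrow> nat \<Rightarrow> 'k" where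
  "dilation_vector V \<theta> x h 0 = blinfun_apply V h"
| "dilation_vector V \<theta> x h (Suc n) =
     blinfun_apply ((\<theta> ^^ Suc n) (extend_op V (x (Suc n)))) (dilation_vector V \<theta> x h n)"

definition minimal_dilation ::
    "('h::complex_hilbert_space \<Rightarrow>\<^sub>L 'h) set \<Rightarrow> ('h \<Rightarrow>\<^sub>L 'h \<Rightarrow> 'h \<Rightarrow>\<^sub>L 'h) \<Rightarrow>
     ('h \<Rightarrow>\<^sub>L 'k::complex_hilbert_space) \<Rightarrow> ('k \<Rightarrow>\<^sub>L 'k) set \<Rightarrow> ('k \<Rightarrow>\<^sub>L 'k \<Rightarrow> 'k \<Rightarrow>\<^sub>L 'k) \<Rightarrow> bool" where
  "minimal_dilation A \<tau> V B \<theta> \<longleftrightarrow>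
     hilbert_embedding V \<and>
     von_neumann_algebra B \<and>
     A = compress_op V ` B \<and>
     normal_unital_star_endomorphism B \<theta> \<and>
     (\<forall>x\<in>A. \<forall>n. (\<tau> ^^ n) x = compress_op V ((\<theta> ^^ n) (extend_op V x))) \<and>
     closure (cspan {dilation_vector V \<theta> x h n | x h n. \<forall>i\<in>{1..n}. x i \<in> A}) = UNIV \<and>
     B = generated_von_neumann_algebra {(\<theta> ^^ n) (extend_op V x) | n x. x \<in> A}"


section \<open>Peripheral spaces\<close>

definition peripheral_eigenspan ::
    "('a::complex_hilbert_space \<Rightarrow>\<^sub>L 'a) set \<Rightarrow> ('a \<Rightarrow>\<^sub>L 'a \<Rightarrow> 'a \<Rightarrow>\<^sub>L 'a) \<Rightarrow> ('a \<Rightarrow>\<^sub>L 'a) set" where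
  "peripheral_eigenspan M f = cspan {x \<in> M. \<exists>c. cmod c = 1 \<and> f x = c *\<^sub>C x}"

definition peripheral_space ::
    "('a::complex_hilbert_space \<Rightarrow>\<^sub>L 'a) set \<Rightarrow> ('a \<Rightarrow>\<^sub>L 'a \<Rightarrow> 'a \<Rightarrow>\<^sub>L 'a) \<Rightarrow> ('a \<Rightarrow>\<^sub>L 'a) set" where
  "peripheral_space M f = closure (peripheral_eigenspan M f)"

end

theory Submission
  imports Defs "HOL-Analysis.Kronecker_Approximation_Theorem"
begin

text \<open>
  Let \<open>V\<close> be the inclusion of \<open>H\<close> into \<open>K\<close>, \<open>p = V V\<^sup>*\<close>, and \<open>T z = V\<^sup>* z V\<close>.  Everything rests on the
  projections \<open>p\<^sub>m = \<theta>\<^sup>m(p)\<close>.  Unitality of \<open>\<tau>\<close> says that \<open>V\<^sup>* p\<^sub>m V = 1\<close>, that is \<open>p \<le> p\<^sub>m\<close>; applying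
  \<open>\<theta>\<^sup>n\<close> shows that the \<open>p\<^sub>m\<close> increase, and minimality of the dilation forces their strong limit to be
  \<open>1\<close> (\<open>proj_tendsto\<close>).  Moreover \<open>p\<^sub>m \<theta>\<^sup>m(z) p\<^sub>m = \<theta>\<^sup>m(p z p)\<close> for all \<open>z\<close> in \<open>B\<close>
  (\<open>compress_funpow_between\<close>), and so \<open>T \<theta>\<^sup>m = \<tau>\<^sup>m T\<close> on \<open>B\<close>: compression maps peripheral
  eigenvectors of \<open>\<theta>\<close> to peripheral eigenvectors of \<open>\<tau>\<close>.

  Why \<open>T\<close> is isometric (\<open>op_matrix_norm_compress_eq\<close>).  Finitely many unimodular numbers have powers
  that are simultaneously close to \<open>1\<close> for arbitrarily large exponents, by Dirichlet's
  approximation theorem.  Hence \<open>\<theta>\<^sup>m(z)\<close> returns arbitrarily close to \<open>z\<close> in norm, for every \<open>z\<close> in the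
  peripheral space of \<open>\<theta>\<close> (\<open>peripheral_recurrence\<close>).  Along such exponents
  \<open>\<theta>\<^sup>m(p z p) = p\<^sub>m \<theta>\<^sup>m(z) p\<^sub>m\<close> tends strongly to \<open>z\<close>, while its norm never exceeds that of \<open>p z p\<close>,
  since star endomorphisms are contractive.  So the norm of \<open>z\<close> is at most that of \<open>T z\<close>.  The same
  argument applies to matrices, because star endomorphisms are completely contractive
  (\<open>star_endomorphism.op_matrix_norm_le\<close>).

  Why \<open>T\<close> is onto (\<open>eigenvector_lift\<close>).  If \<open>\<tau>(x) = c x\<close> with \<open>c\<close> unimodular, then the bounded operators
  \<open>z\<^sub>n = c\<^sup>-\<^sup>n \<theta>\<^sup>n(V x V\<^sup>*)\<close> satisfy \<open>p\<^sub>n z\<^sub>m p\<^sub>n = z\<^sub>n\<close> for \<open>n \<le> m\<close>.  Like a martingale, such a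
  sequence converges strongly (\<open>increasing_projections_limit\<close>).  The limit \<open>w\<close> lies in \<open>B\<close> and
  satisfies \<open>p\<^sub>n w p\<^sub>n = z\<^sub>n\<close>; comparing corners gives \<open>\<theta>(w) = c w\<close>, and the corner for \<open>n = 0\<close> gives
  \<open>T w = x\<close>.  So \<open>T\<close> maps the span of the peripheral eigenvectors of \<open>\<theta>\<close> onto that of \<open>\<tau>\<close>, and being
  isometric it maps closure onto closure.  The \<open>C\<^sup>*\<close>-structure of the peripheral space of \<open>\<theta>\<close>, a
  norm-closed star algebra of operators, is then transported along \<open>T\<close>.
\<close>

section \<open>Adjoints\<close>

instance complex_hilbert_space \<subseteq> banach ..

text \<open>The representing vector is the point where the strictly convex functional
  \<open>q x = \<parallel>x\<parallel>\<^sup>2 / 2 - f x\<close> attains its minimum.  The parallelogram law bounds the distance of two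
  points by the excess of \<open>q\<close> over its infimum, so every minimising sequence is Cauchy.\<close>

lemma riesz_representation:
  fixes f :: "'a::{real_inner,complete_space} \<Rightarrow> real"
  assumes "bounded_linear f"
  obtains y where "\<And>x. f x = y \<bullet> x"
proof -
  interpret bounded_linear f by fact
  define q where "q x = (norm x)\<^sup>2 / 2 - f x" for x
  obtain K where K: "\<And>x. norm (f x) \<le> norm x * K"
    using bounded by blast
  have lower: "q x \<ge> - (K\<^sup>2 / 2)" for x
    using K[of x] zero_le_power2[of "norm x - K"]
    by (simp add: q_def power2_diff)
  then have bdd: "bdd_below (range q)"
    by (rule bdd_belowI2)
  define m where "m = Inf (range q)"
  have m_le: "m \<le> q x" for x
    unfolding m_def by (rule cInf_lower[OF _ bdd]) simp
  have "\<exists>x. q x < m + 1 / real (Suc n)" for n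
    using cInf_lessD[of "range q" "m + 1 / real (Suc n)"] unfolding m_def by auto
  then obtain X where X: "\<And>n. q (X n) < m + 1 / real (Suc n)"
    by metis
  have para: "(norm (a - b))\<^sup>2 = 4 * (q a + q b - 2 * q ((1/2) *\<^sub>R (a + b)))" for a b
    unfolding q_def power2_norm_eq_inner
    by (simp add: scaleR add inner_simps inner_commute[of b a] field_simps)
  have "Cauchy X"
  proof (rule CauchyI)
    fix e :: real assume e: "e > 0"
    obtain M where M: "1 / real (Suc M) < e\<^sup>2 / 8"
      using nat_approx_posE[of "e\<^sup>2 / 8"] e by (auto simp: zero_less_power2)
    have "norm (X a - X b) < e" if "a \<ge> M" "b \<ge> M" for a b
    proof -
      have "1 / real (Suc a) \<le> 1 / real (Suc M)" "1 / real (Suc b) \<le> 1 / real (Suc M)"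
        using that by (auto simp: field_simps)
      then have "q (X a) < m + e\<^sup>2 / 8" "q (X b) < m + e\<^sup>2 / 8"
        using X[of a] X[of b] M by linarith+
      then have "(norm (X a - X b))\<^sup>2 < e\<^sup>2"
        using para[of "X a" "X b"] m_le[of "(1/2) *\<^sub>R (X a + X b)"] by argo
      then show ?thesis
        using e power2_less_imp_less less_imp_le by blast
    qed
    then show "\<exists>M. \<forall>m\<ge>M. \<forall>n\<ge>M. norm (X m - X n) < e" by blast
  qed
  then obtain y where y: "X \<longlonglongrightarrow> y"
    using Cauchy_convergent convergent_def by blast
  have "(\<lambda>n. q (X n)) \<longlonglongrightarrow> q y"
    unfolding q_def by (intro tendsto_intros tendsto y) simp
  moreover have "(\<lambda>n. m + 1 / real (Suc n)) \<longlonglongrightarrow> m + 0"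
    by (intro tendsto_intros LIMSEQ_Suc[OF lim_1_over_n])
  ultimately have "q y \<le> m"
    using LIMSEQ_le X less_imp_le by (metis (no_types, lifting) add.right_neutral)
  then have min: "q y \<le> q (y + t *\<^sub>R h)" for t h
    using m_le order_trans by blast
  have "f h = y \<bullet> h" for h
  proof (cases "h = 0")
    case False
    define d where "d = y \<bullet> h - f h"
    define s where "s = h \<bullet> h"
    have s: "s > 0" using False by (simp add: s_def)
    have exp: "q (y + t *\<^sub>R h) = q y + t * d + t\<^sup>2 * s / 2" for t
      unfolding q_def d_def s_def power2_norm_eq_inner
      by (simp add: add scaleR inner_simps inner_commute[of h y] field_simps power2_eq_square)
    \<comment> \<open>The step \<open>- d / s\<close> minimises \<open>q\<close> on the line through \<open>y\<close> in direction \<open>h\<close>.\<close>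
    have "0 \<le> (- d / s) * d + (- d / s)\<^sup>2 * s / 2"
      using min[of "- d / s" h] exp[of "- d / s"] by linarith
    also have "\<dots> = - (d\<^sup>2 / (2 * s))"
      using s by (simp add: field_simps power2_eq_square)
    finally have "d\<^sup>2 / (2 * s) \<le> 0" by simp
    then have "d = 0" using s by (simp add: divide_le_0_iff)
    then show ?thesis by (simp add: d_def)
  qed (simp add: zero)
  then show thesis using that by blast
qed

lemma bounded_bilinear_scaleC:
  "bounded_bilinear (scaleC :: complex \<Rightarrow> 'a \<Rightarrow> 'a::complex_normed_vector)"
proof
  fix a b :: complex and x y :: 'a and r :: real
  show "(a + b) *\<^sub>C x = a *\<^sub>C x + b *\<^sub>C x" "a *\<^sub>C (x + y) = a *\<^sub>C x + a *\<^sub>C y"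
    by (simp_all add: scaleC_add_left scaleC_add_right)
  show "(r *\<^sub>R a) *\<^sub>C x = r *\<^sub>R a *\<^sub>C x" "a *\<^sub>C r *\<^sub>R x = r *\<^sub>R a *\<^sub>C x"
    by (simp_all add: scaleR_conv_of_real scaleC_scaleC mult.commute flip: scaleC_of_real)
  show "\<exists>K. \<forall>a (x :: 'a). norm (a *\<^sub>C x) \<le> norm a * norm x * K"
    by (intro exI[of _ 1]) (simp add: norm_scaleC)
qed

lemmas tendsto_scaleC = bounded_bilinear.tendsto[OF bounded_bilinear_scaleC]

lemma cinner_scaleC_left: "cinner (a *\<^sub>C x) y = cnj a * cinner x y"
  using cinner_commute[of "a *\<^sub>C x" y] cinner_commute[of x y]
  by (simp add: cinner_scaleC_right)

lemma Im_cinner: "Im (cinner x y) = (\<i> *\<^sub>C x) \<bullet> y"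
  by (simp add: Re_cinner[symmetric] cinner_scaleC_left)

lemma bounded_ops_scaleC: "x \<in> bounded_ops \<Longrightarrow> x (c *\<^sub>C v) = c *\<^sub>C x v"
  by (simp add: bounded_ops_def)

text \<open>Since the imaginary part of \<open>\<langle>u, v\<rangle>\<close> is the real part of \<open>\<langle>\<i> u, v\<rangle>\<close>, an identity of real inner
  products between complex-linear expressions is one of complex inner products.  Adjoints can
  therefore be computed with the real inner product throughout.\<close>

lemma cinner_eq_of_inner_eq:
  fixes x :: "'a::complex_hilbert_space \<Rightarrow>\<^sub>L 'b::complex_hilbert_space" and y :: "'b \<Rightarrow>\<^sub>L 'a"
  assumes "x \<in> bounded_ops" and "\<And>u v. x u \<bullet> v = u \<bullet> y v"
  shows "cinner (x u) v = cinner u (y v)"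
  by (rule complex_eqI)
    (simp_all add: Re_cinner Im_cinner assms(2) flip: bounded_ops_scaleC[OF assms(1)])

lemma adj_eqI:
  fixes x :: "'a::complex_hilbert_space \<Rightarrow>\<^sub>L 'b::complex_hilbert_space" and y :: "'b \<Rightarrow>\<^sub>L 'a"
  assumes "x \<in> bounded_ops" and eq: "\<And>u v. x u \<bullet> v = u \<bullet> y v"
  shows "adj x = y"
  unfolding adj_def
proof (rule the_equality)
  show "\<forall>u v. cinner (x u) v = cinner u (y v)"
    using cinner_eq_of_inner_eq[OF assms] by blast
  fix z assume z: "\<forall>u v. cinner (x u) v = cinner u (blinfun_apply z v)"
  have "u \<bullet> z v = u \<bullet> y v" for u v
    using z eq by (metis Re_cinner)
  then show "z = y"
    by (intro blinfun_eqI) (metis vector_eq_rdot inner_commute)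
qed

text \<open>Existence of the adjoint: \<open>adj\<close> is a definite description, which the representation theorem
  shows to be satisfied.\<close>

lemma inner_adj:
  fixes x :: "'a::complex_hilbert_space \<Rightarrow>\<^sub>L 'b::complex_hilbert_space"
  assumes "x \<in> bounded_ops"
  shows "x u \<bullet> v = u \<bullet> adj x v"
proof -
  have "\<exists>y. \<forall>u. x u \<bullet> v = u \<bullet> y" for v
  proof -
    have "bounded_linear (\<lambda>u. x u \<bullet> v)"
      by (intro bounded_linear_intros)
    then obtain y where "\<And>u. x u \<bullet> v = y \<bullet> u"
      using riesz_representation by blast
    then show ?thesis by (metis inner_commute)
  qed
  then obtain f where f: "\<And>u v. x u \<bullet> v = u \<bullet> f v" by metis
  have "bounded_linear f"
  proof (rule bounded_linear_intro[where K = "norm x"])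
    fix v w r
    show "f (v + w) = f v + f w"
      by (rule vector_eq_ldot[THEN iffD1]) (simp add: inner_simps flip: f)
    show "f (r *\<^sub>R v) = r *\<^sub>R f v"
      by (rule vector_eq_ldot[THEN iffD1]) (simp add: inner_simps flip: f)
    have "(norm (f v))\<^sup>2 = x (f v) \<bullet> v"
      by (simp add: f power2_norm_eq_inner)
    also have "\<dots> \<le> norm (x (f v)) * norm v"
      by (rule norm_cauchy_schwarz)
    also have "\<dots> \<le> (norm x * norm (f v)) * norm v"
      by (intro mult_right_mono norm_blinfun) simp
    finally show "norm (f v) \<le> norm v * norm x"
      by (cases "f v = 0") (simp_all add: power2_eq_square mult_ac)
  qed
  then have "adj x = Blinfun f"
    by (intro adj_eqI assms) (simp add: bounded_linear_Blinfun_apply f)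
  then show ?thesis
    using \<open>bounded_linear f\<close> by (simp add: bounded_linear_Blinfun_apply f)
qed

lemma inner_adj':
  fixes x :: "'a::complex_hilbert_space \<Rightarrow>\<^sub>L 'b::complex_hilbert_space"
  assumes "x \<in> bounded_ops"
  shows "v \<bullet> x u = adj x v \<bullet> u"
  using inner_adj[OF assms] by (metis inner_commute)

lemma adj_bounded_ops:
  fixes x :: "'a::complex_hilbert_space \<Rightarrow>\<^sub>L 'b::complex_hilbert_space"
  assumes "x \<in> bounded_ops"
  shows "adj x \<in> bounded_ops"
proof -
  have "u \<bullet> adj x (c *\<^sub>C v) = u \<bullet> (c *\<^sub>C adj x v)" for c u v
  proof -
    have "cinner u (adj x (c *\<^sub>C v)) = cinner (x u) (c *\<^sub>C v)"
      by (rule cinner_eq_of_inner_eq[symmetric]) (simp_all add: assms inner_adj)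
    also have "\<dots> = c * cinner (x u) v"
      by (rule cinner_scaleC_right)
    also have "\<dots> = c * cinner u (adj x v)"
      by (subst cinner_eq_of_inner_eq[of x "adj x"]) (simp_all add: assms inner_adj)
    also have "\<dots> = cinner u (c *\<^sub>C adj x v)"
      by (simp add: cinner_scaleC_right)
    finally show ?thesis by (metis Re_cinner)
  qed
  then show ?thesis
    unfolding bounded_ops_def by (blast intro: vector_eq_ldot[THEN iffD1])
qed

lemma cinner_adj:
  fixes x :: "'a::complex_hilbert_space \<Rightarrow>\<^sub>L 'b::complex_hilbert_space"
  assumes "x \<in> bounded_ops"
  shows "cinner (x u) v = cinner u (adj x v)"
  by (intro cinner_eq_of_inner_eq inner_adj assms)

lemma adj_adj:
  fixes x :: "'a::complex_hilbert_space \<Rightarrow>\<^sub>L 'b::complex_hilbert_space"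
  assumes "x \<in> bounded_ops"
  shows "adj (adj x) = x"
  using assms by (intro adj_eqI adj_bounded_ops) (simp_all add: inner_adj')

lemma bounded_ops_compose:
  assumes "x \<in> bounded_ops" "y \<in> bounded_ops"
  shows "x o\<^sub>L y \<in> bounded_ops"
  using assms by (simp add: bounded_ops_def)

lemma csubspace_bounded_ops: "csubspace bounded_ops"
  by (auto simp: complex_vector.subspace_def bounded_ops_def blinfun.bilinear_simps
      scaleC_add_right scaleC_blinfun.rep_eq scaleC_scaleC mult.commute)

lemma adj_compose:
  fixes x :: "'b::complex_hilbert_space \<Rightarrow>\<^sub>L 'c::complex_hilbert_space"
    and y :: "'a::complex_hilbert_space \<Rightarrow>\<^sub>L 'b"
  assumes "x \<in> bounded_ops" "y \<in> bounded_ops"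
  shows "adj (x o\<^sub>L y) = adj y o\<^sub>L adj x"
  by (intro adj_eqI) (simp_all add: assms bounded_ops_compose inner_adj)

lemma adj_add:
  fixes x y :: "'a::complex_hilbert_space \<Rightarrow>\<^sub>L 'b::complex_hilbert_space"
  assumes "x \<in> bounded_ops" "y \<in> bounded_ops"
  shows "adj (x + y) = adj x + adj y"
  using assms complex_vector.subspace_add[OF csubspace_bounded_ops]
  by (intro adj_eqI) (simp_all add: inner_adj blinfun.bilinear_simps inner_simps)

lemma inner_scaleC_left:
  fixes u v :: "'a::complex_hilbert_space"
  shows "(c *\<^sub>C u) \<bullet> v = u \<bullet> (cnj c *\<^sub>C v)"
  by (simp add: cinner_scaleC_left cinner_scaleC_right flip: Re_cinner)

lemma adj_scaleC:
  fixes x :: "'a::complex_hilbert_space \<Rightarrow>\<^sub>L 'b::complex_hilbert_space"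
  assumes "x \<in> bounded_ops"
  shows "adj (c *\<^sub>C x) = cnj c *\<^sub>C adj x"
proof (rule adj_eqI)
  show "c *\<^sub>C x \<in> bounded_ops"
    using assms by (rule complex_vector.subspace_scale[OF csubspace_bounded_ops])
  show "(c *\<^sub>C x) u \<bullet> v = u \<bullet> (cnj c *\<^sub>C adj x) v" for u v
    using bounded_ops_scaleC[OF adj_bounded_ops[OF assms]] assms
    by (simp add: scaleC_blinfun.rep_eq inner_scaleC_left inner_adj)
qed

lemma adj_diff:
  fixes x y :: "'a::complex_hilbert_space \<Rightarrow>\<^sub>L 'b::complex_hilbert_space"
  assumes "x \<in> bounded_ops" "y \<in> bounded_ops"
  shows "adj (x - y) = adj x - adj y"
  using assms complex_vector.subspace_diff[OF csubspace_bounded_ops]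
  by (intro adj_eqI) (simp_all add: inner_adj blinfun.bilinear_simps inner_simps)

lemma norm_adj_le:
  fixes x :: "'a::complex_hilbert_space \<Rightarrow>\<^sub>L 'b::complex_hilbert_space"
  assumes "x \<in> bounded_ops"
  shows "norm (adj x) \<le> norm x"
proof (rule norm_blinfun_bound)
  fix v
  have "(norm (adj x v))\<^sup>2 = x (adj x v) \<bullet> v"
    by (simp add: inner_adj assms power2_norm_eq_inner)
  also have "\<dots> \<le> norm (x (adj x v)) * norm v"
    by (rule norm_cauchy_schwarz)
  also have "\<dots> \<le> (norm x * norm (adj x v)) * norm v"
    by (intro mult_right_mono norm_blinfun) simp
  finally show "norm (adj x v) \<le> norm x * norm v"
    by (cases "adj x v = 0") (simp_all add: power2_eq_square mult_ac)
qed simp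

lemma norm_adj:
  fixes x :: "'a::complex_hilbert_space \<Rightarrow>\<^sub>L 'b::complex_hilbert_space"
  assumes "x \<in> bounded_ops"
  shows "norm (adj x) = norm x"
  using norm_adj_le[OF assms] norm_adj_le[OF adj_bounded_ops[OF assms]]
  by (simp add: adj_adj assms)

lemma norm_adj_compose_self:
  fixes x :: "'a::complex_hilbert_space \<Rightarrow>\<^sub>L 'b::complex_hilbert_space"
  assumes "x \<in> bounded_ops"
  shows "norm (adj x o\<^sub>L x) = (norm x)\<^sup>2"
proof (rule antisym)
  show "norm (adj x o\<^sub>L x) \<le> (norm x)\<^sup>2"
    using norm_blinfun_compose[of "adj x" x] by (simp add: norm_adj assms power2_eq_square)
  have "norm x \<le> sqrt (norm (adj x o\<^sub>L x))"
  proof (rule norm_blinfun_bound)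
    fix v
    have "(norm (x v))\<^sup>2 = v \<bullet> (adj x o\<^sub>L x) v"
      by (simp add: assms power2_norm_eq_inner flip: inner_adj)
    also have "\<dots> \<le> norm v * norm ((adj x o\<^sub>L x) v)"
      by (rule norm_cauchy_schwarz)
    also have "\<dots> \<le> norm v * (norm (adj x o\<^sub>L x) * norm v)"
      by (intro mult_left_mono norm_blinfun) simp
    finally have "(norm (x v))\<^sup>2 \<le> (sqrt (norm (adj x o\<^sub>L x)) * norm v)\<^sup>2"
      by (simp add: power_mult_distrib power2_eq_square mult_ac)
    then show "norm (x v) \<le> sqrt (norm (adj x o\<^sub>L x)) * norm v"
      by (rule power2_le_imp_le) simp
  qed simp
  then show "(norm x)\<^sup>2 \<le> norm (adj x o\<^sub>L x)"
    by (metis norm_ge_zero real_sqrt_pow2 power_mono)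
qed


section \<open>Operator matrices\<close>

definition tuple_norm :: "nat \<Rightarrow> (nat \<Rightarrow> 'a::real_normed_vector) \<Rightarrow> real" where
  "tuple_norm n v = L2_set (\<lambda>i. norm (v i)) {..<n}"

definition mat_apply ::
    "nat \<Rightarrow> (nat \<Rightarrow> nat \<Rightarrow> 'a::real_normed_vector \<Rightarrow>\<^sub>L 'b::real_normed_vector) \<Rightarrow> (nat \<Rightarrow> 'a) \<Rightarrow> nat \<Rightarrow> 'b" where
  "mat_apply n X v i = (\<Sum>j<n. X i j (v j))"

lemma op_matrix_norm_alt:
  "op_matrix_norm n X = (SUP v \<in> {v. tuple_norm n v \<le> 1}. tuple_norm n (mat_apply n X v))"
  by (simp add: op_matrix_norm_def tuple_norm_def mat_apply_def)

lemma op_matrix_norm_cong: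
  assumes "\<And>i j. i < n \<Longrightarrow> j < n \<Longrightarrow> X i j = Y i j"
  shows "op_matrix_norm n X = op_matrix_norm n Y"
proof -
  have "L2_set (\<lambda>i. norm (\<Sum>j<n. X i j (v j))) {..<n} = L2_set (\<lambda>i. norm (\<Sum>j<n. Y i j (v j))) {..<n}" for v
    using assms by (intro L2_set_cong arg_cong[where f = norm] sum.cong) auto
  then show ?thesis by (simp add: op_matrix_norm_def)
qed

lemma tuple_norm_nonneg: "0 \<le> tuple_norm n v"
  by (simp add: tuple_norm_def)

lemma tuple_norm_power2: "(tuple_norm n v)\<^sup>2 = (\<Sum>i<n. v i \<bullet> v i)"
  for v :: "nat \<Rightarrow> 'a::real_inner"
  by (simp add: tuple_norm_def L2_set_def sum_nonneg power2_norm_eq_inner)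

lemma tuple_norm_scaleR: "tuple_norm n (\<lambda>i. c *\<^sub>R v i) = \<bar>c\<bar> * tuple_norm n v"
  by (simp add: tuple_norm_def L2_set_right_distrib)

lemma norm_le_tuple_norm: "i < n \<Longrightarrow> norm (v i) \<le> tuple_norm n v"
  unfolding tuple_norm_def by (rule member_le_L2_set) simp_all

lemma tuple_cauchy_schwarz:
  fixes u v :: "nat \<Rightarrow> 'a::real_inner"
  shows "(\<Sum>i<n. u i \<bullet> v i) \<le> tuple_norm n u * tuple_norm n v"
proof -
  have "(\<Sum>i<n. u i \<bullet> v i) \<le> (\<Sum>i<n. \<bar>norm (u i)\<bar> * \<bar>norm (v i)\<bar>)"
    by (intro sum_mono) (simp add: norm_cauchy_schwarz)
  also have "\<dots> \<le> tuple_norm n u * tuple_norm n v"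
    unfolding tuple_norm_def by (rule L2_set_mult_ineq)
  finally show ?thesis .
qed

lemma tuple_norm_mat_apply_crude:
  "tuple_norm n (mat_apply n X v) \<le> (\<Sum>i<n. \<Sum>j<n. norm (X i j)) * tuple_norm n v"
proof -
  have "tuple_norm n (mat_apply n X v) \<le> (\<Sum>i<n. norm (mat_apply n X v i))"
    unfolding tuple_norm_def by (rule L2_set_le_sum) simp
  also have "\<dots> \<le> (\<Sum>i<n. \<Sum>j<n. norm (X i j) * tuple_norm n v)"
    unfolding mat_apply_def
  proof (intro sum_mono order_trans[OF norm_sum])
    fix i j assume "j \<in> {..<n}"
    then have "norm (v j) \<le> tuple_norm n v"
      by (simp add: norm_le_tuple_norm)
    then show "norm (X i j (v j)) \<le> norm (X i j) * tuple_norm n v"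
      by (rule order_trans[OF norm_blinfun mult_left_mono]) simp
  qed
  finally show ?thesis by (simp add: sum_distrib_right)
qed

lemma bdd_above_op_matrix_norm:
  "bdd_above ((\<lambda>v. tuple_norm n (mat_apply n X v)) ` {v. tuple_norm n v \<le> 1})"
proof (rule bdd_aboveI2)
  fix v :: "nat \<Rightarrow> 'a" assume "v \<in> {v. tuple_norm n v \<le> 1}"
  then show "tuple_norm n (mat_apply n X v) \<le> (\<Sum>i<n. \<Sum>j<n. norm (X i j))"
    using tuple_norm_mat_apply_crude[of n X v]
      mult_left_le[of "tuple_norm n v" "\<Sum>i<n. \<Sum>j<n. norm (X i j)"]
    by (simp add: sum_nonneg)
qed

lemma tuple_norm_zero: "tuple_norm n (\<lambda>_. 0) = 0"
  by (simp add: tuple_norm_def L2_set_def)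

lemma op_matrix_norm_nonneg: "0 \<le> op_matrix_norm n X"
proof -
  have "tuple_norm n (mat_apply n X (\<lambda>_. 0)) \<le> op_matrix_norm n X"
    unfolding op_matrix_norm_alt
    by (rule cSUP_upper[OF _ bdd_above_op_matrix_norm]) (simp add: tuple_norm_zero)
  then show ?thesis using tuple_norm_nonneg order_trans by blast
qed

lemma tuple_norm_mat_apply_le:
  "tuple_norm n (mat_apply n X v) \<le> op_matrix_norm n X * tuple_norm n v"
proof (cases "tuple_norm n v = 0")
  case True
  then show ?thesis
    using tuple_norm_mat_apply_crude[of n X v] by simp
next
  case False
  then have pos: "tuple_norm n v > 0"
    using tuple_norm_nonneg[of n v] by linarith
  define w where "w i = inverse (tuple_norm n v) *\<^sub>R v i" for i
  have "tuple_norm n w \<le> 1"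
    using pos by (simp add: w_def[abs_def] tuple_norm_scaleR)
  then have "tuple_norm n (mat_apply n X w) \<le> op_matrix_norm n X"
    unfolding op_matrix_norm_alt
    by (intro cSUP_upper bdd_above_op_matrix_norm) simp
  moreover have "mat_apply n X w = (\<lambda>i. inverse (tuple_norm n v) *\<^sub>R mat_apply n X v i)"
    by (simp add: w_def mat_apply_def fun_eq_iff blinfun.bilinear_simps scaleR_sum_right)
  ultimately show ?thesis
    using pos by (simp add: tuple_norm_scaleR field_simps)
qed

lemma op_matrix_norm_least:
  assumes "0 \<le> c" and "\<And>v. tuple_norm n (mat_apply n X v) \<le> c * tuple_norm n v"
  shows "op_matrix_norm n X \<le> c"
  unfolding op_matrix_norm_alt
proof (rule cSUP_least)
  show "{v. tuple_norm n v \<le> 1} \<noteq> {}"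
    using tuple_norm_zero[of n] by (metis (mono_tags) empty_iff mem_Collect_eq zero_le_one)
  fix v :: "nat \<Rightarrow> 'a" assume "v \<in> {v. tuple_norm n v \<le> 1}"
  then show "tuple_norm n (mat_apply n X v) \<le> c"
    using assms(2)[of v] mult_left_le[of "tuple_norm n v" c] assms(1) by simp
qed

lemma op_matrix_norm_le_sum: "op_matrix_norm n X \<le> (\<Sum>i<n. \<Sum>j<n. norm (X i j))"
  by (intro op_matrix_norm_least tuple_norm_mat_apply_crude sum_nonneg norm_ge_zero)

lemma norm_entry_le:
  fixes X :: "nat \<Rightarrow> nat \<Rightarrow> 'a::complex_hilbert_space \<Rightarrow>\<^sub>L 'a"
  assumes "i < n" "j < n"
  shows "norm (X i j) \<le> op_matrix_norm n X"
proof (rule norm_blinfun_bound[OF op_matrix_norm_nonneg])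
  fix u :: 'a
  define v where "v k = (if k = j then u else 0)" for k
  have "(\<Sum>k<n. (norm (v k))\<^sup>2) = (\<Sum>k<n. if k = j then (norm u)\<^sup>2 else 0)"
    by (rule sum.cong) (auto simp: v_def)
  then have "tuple_norm n v = norm u"
    using assms by (simp add: tuple_norm_def L2_set_def)
  moreover have "mat_apply n X v i = (\<Sum>k<n. if k = j then X i j u else 0)"
    unfolding mat_apply_def by (rule sum.cong) (auto simp: v_def)
  then have "mat_apply n X v i = X i j u"
    using assms by simp
  ultimately show "norm (X i j u) \<le> op_matrix_norm n X * norm u"
    using norm_le_tuple_norm[OF assms(1), of "mat_apply n X v"] tuple_norm_mat_apply_le[of n X v]
    by simp
qed

lemma op_matrix_norm_1: "op_matrix_norm 1 X = norm (X 0 0)"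
  using op_matrix_norm_le_sum[of 1 X] norm_entry_le[of 0 1 0 X] by simp

lemma op_matrix_norm_compress:
  fixes a :: "'a::complex_hilbert_space \<Rightarrow>\<^sub>L 'b::complex_hilbert_space" and b :: "'b \<Rightarrow>\<^sub>L 'a"
  assumes "norm a \<le> 1" "norm b \<le> 1"
  shows "op_matrix_norm n (\<lambda>i j. a o\<^sub>L X i j o\<^sub>L b) \<le> op_matrix_norm n X"
proof (rule op_matrix_norm_least[OF op_matrix_norm_nonneg])
  fix v :: "nat \<Rightarrow> 'b"
  have contract: "norm (blinfun_apply c u) \<le> norm u" if "norm c \<le> 1"
    for c :: "'c::real_normed_vector \<Rightarrow>\<^sub>L 'd::real_normed_vector" and u
    using norm_blinfun[of c u] mult_right_mono[OF that norm_ge_zero[of u]] by simp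
  have "mat_apply n (\<lambda>i j. a o\<^sub>L X i j o\<^sub>L b) v = (\<lambda>i. a (mat_apply n X (\<lambda>j. b (v j)) i))"
    by (simp add: fun_eq_iff mat_apply_def blinfun.sum_right)
  then have "tuple_norm n (mat_apply n (\<lambda>i j. a o\<^sub>L X i j o\<^sub>L b) v)
      \<le> tuple_norm n (mat_apply n X (\<lambda>j. b (v j)))"
    unfolding tuple_norm_def by (simp add: L2_set_mono contract assms(1))
  also have "\<dots> \<le> op_matrix_norm n X * tuple_norm n (\<lambda>j. b (v j))"
    by (rule tuple_norm_mat_apply_le)
  also have "\<dots> \<le> op_matrix_norm n X * tuple_norm n v"
    unfolding tuple_norm_def
    by (intro mult_left_mono op_matrix_norm_nonneg L2_set_mono contract assms(2) norm_ge_zero)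
  finally show "tuple_norm n (mat_apply n (\<lambda>i j. a o\<^sub>L X i j o\<^sub>L b) v) \<le> op_matrix_norm n X * tuple_norm n v" .
qed

text \<open>The product \<open>X\<^sup>* X\<close> of operator matrices.\<close>

definition mat_square ::
    "nat \<Rightarrow> (nat \<Rightarrow> nat \<Rightarrow> 'a::complex_hilbert_space \<Rightarrow>\<^sub>L 'a) \<Rightarrow> nat \<Rightarrow> nat \<Rightarrow> 'a \<Rightarrow>\<^sub>L 'a" where
  "mat_square n X i j = (\<Sum>k<n. adj (X k i) o\<^sub>L X k j)"

lemma blinfun_apply_sum: "blinfun_apply (\<Sum>k\<in>I. x k) v = (\<Sum>k\<in>I. blinfun_apply (x k) v)"
  by (rule blinfun.sum_left)

lemma inner_mat_square:
  assumes "X \<in> op_matrices n bounded_ops"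
  shows "(\<Sum>i<n. u i \<bullet> mat_apply n (mat_square n X) v i) =
    (\<Sum>k<n. mat_apply n X u k \<bullet> mat_apply n X v k)"
proof -
  have "(\<Sum>i<n. u i \<bullet> mat_apply n (mat_square n X) v i) =
      (\<Sum>i<n. \<Sum>j<n. \<Sum>k<n. X k i (u i) \<bullet> X k j (v j))"
    using assms
    by (intro sum.cong refl)
      (simp add: mat_apply_def mat_square_def blinfun_apply_sum inner_sum_right op_matrices_def
        inner_adj)
  also have "\<dots> = (\<Sum>i<n. \<Sum>k<n. \<Sum>j<n. X k i (u i) \<bullet> X k j (v j))"
    by (intro sum.cong[OF refl] sum.swap)
  also have "\<dots> = (\<Sum>k<n. \<Sum>i<n. \<Sum>j<n. X k i (u i) \<bullet> X k j (v j))"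
    by (rule sum.swap)
  also have "\<dots> = (\<Sum>k<n. mat_apply n X u k \<bullet> mat_apply n X v k)"
    unfolding mat_apply_def inner_sum_left inner_sum_right by (intro sum.cong[OF refl] sum.swap)
  finally show ?thesis .
qed

text \<open>The \<open>C\<^sup>*\<close>-identity for operator matrices.  Both inequalities come from
  \<open>\<langle>u, X\<^sup>* X v\<rangle> = \<langle>X u, X v\<rangle>\<close> and the Cauchy-Schwarz inequality on the \<open>n\<close>-fold Hilbert sum, with
  \<open>u = X\<^sup>* X v\<close> for the upper bound and \<open>u = v\<close> for the lower one.\<close>

lemma op_matrix_norm_square:
  assumes "X \<in> op_matrices n bounded_ops"
  shows "op_matrix_norm n (mat_square n X) = (op_matrix_norm n X)\<^sup>2"
proof (rule antisym)
  let ?N = "op_matrix_norm n X" and ?S = "mat_square n X"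
  show "op_matrix_norm n ?S \<le> ?N\<^sup>2"
  proof (rule op_matrix_norm_least)
    fix v :: "nat \<Rightarrow> 'a"
    let ?w = "mat_apply n ?S v"
    have "(tuple_norm n ?w)\<^sup>2 = (\<Sum>k<n. mat_apply n X ?w k \<bullet> mat_apply n X v k)"
      unfolding tuple_norm_power2 by (rule inner_mat_square[OF assms])
    also have "\<dots> \<le> tuple_norm n (mat_apply n X ?w) * tuple_norm n (mat_apply n X v)"
      by (rule tuple_cauchy_schwarz)
    also have "\<dots> \<le> (?N * tuple_norm n ?w) * (?N * tuple_norm n v)"
      by (intro mult_mono tuple_norm_mat_apply_le mult_nonneg_nonneg op_matrix_norm_nonneg
          tuple_norm_nonneg)
    finally show "tuple_norm n ?w \<le> ?N\<^sup>2 * tuple_norm n v"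
      using tuple_norm_nonneg[of n ?w] tuple_norm_nonneg[of n v]
      by (cases "tuple_norm n ?w = 0")
        (simp_all add: power2_eq_square mult_ac op_matrix_norm_nonneg)
  qed simp
  have "?N \<le> sqrt (op_matrix_norm n ?S)"
  proof (rule op_matrix_norm_least)
    fix v :: "nat \<Rightarrow> 'a"
    have "(tuple_norm n (mat_apply n X v))\<^sup>2 = (\<Sum>i<n. v i \<bullet> mat_apply n ?S v i)"
      unfolding tuple_norm_power2 by (rule inner_mat_square[OF assms, symmetric])
    also have "\<dots> \<le> tuple_norm n v * tuple_norm n (mat_apply n ?S v)"
      by (rule tuple_cauchy_schwarz)
    also have "\<dots> \<le> tuple_norm n v * (op_matrix_norm n ?S * tuple_norm n v)"
      by (intro mult_left_mono tuple_norm_mat_apply_le tuple_norm_nonneg)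
    finally have "(tuple_norm n (mat_apply n X v))\<^sup>2
        \<le> (sqrt (op_matrix_norm n ?S) * tuple_norm n v)\<^sup>2"
      by (simp add: power_mult_distrib op_matrix_norm_nonneg power2_eq_square mult_ac)
    then show "tuple_norm n (mat_apply n X v) \<le> sqrt (op_matrix_norm n ?S) * tuple_norm n v"
      by (rule power2_le_imp_le) (simp add: op_matrix_norm_nonneg tuple_norm_nonneg)
  qed (simp add: op_matrix_norm_nonneg)
  then show "?N\<^sup>2 \<le> op_matrix_norm n ?S"
    by (metis op_matrix_norm_nonneg real_sqrt_pow2 power_mono)
qed


section \<open>Star endomorphisms of von Neumann algebras are completely contractive\<close>

lemma closed_von_neumann_algebra:
  assumes "von_neumann_algebra M"
  shows "closed M"
proof -
  have "closedin strong_operator_topology M"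
    using assms unfolding von_neumann_algebra_def by blast
  then have "closedin euclidean {x \<in> topspace euclidean. x \<in> M}"
    by (rule closedin_continuous_map_preimage[OF strong_operator_topology_weaker_than_euclidean])
  then show ?thesis
    unfolding closed_closedin topspace_euclidean by (simp only: UNIV_I simp_thms Collect_mem_eq)
qed

text \<open>Pointwise convergence is convergence in the strong operator topology because that topology is
  pulled back from the product topology on functions.\<close>

lemma von_neumann_algebra_strong_limit:
  assumes M: "von_neumann_algebra M" and x: "\<And>n. x n \<in> M"
    and lim: "\<And>v. (\<lambda>n. blinfun_apply (x n) v) \<longlonglongrightarrow> blinfun_apply z v"
  shows "z \<in> M"
proof (rule limitin_closedin)
  show "closedin strong_operator_topology M"
    using M unfolding von_neumann_algebra_def by blast
  show "limitin strong_operator_topology x z sequentially"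
    unfolding limitin_def strong_operator_topology_topspace
  proof (intro conjI allI impI)
    fix U :: "('a \<Rightarrow>\<^sub>L 'a) set"
    assume U: "openin strong_operator_topology U \<and> z \<in> U"
    then obtain W where W: "open W" "U = blinfun_apply -` W"
      by (auto simp: strong_operator_topology_def openin_pullback_topology)
    have "limitin (product_topology (\<lambda>_. euclidean) UNIV)
        (\<lambda>n. blinfun_apply (x n)) (blinfun_apply z) sequentially"
      using lim by (simp add: limitin_componentwise del: euclidean_product_topology)
    then have "((\<lambda>n. blinfun_apply (x n)) \<longlongrightarrow> blinfun_apply z) sequentially"
      by (simp add: euclidean_product_topology)
    then have "\<forall>\<^sub>F n in sequentially. blinfun_apply (x n) \<in> W"
      using topological_tendstoD W U by blast
    then show "\<forall>\<^sub>F n in sequentially. x n \<in> U"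
      using W by simp
  qed simp
qed (use x in auto)

locale star_endomorphism =
  fixes B :: "('k::complex_hilbert_space \<Rightarrow>\<^sub>L 'k) set" and \<theta> :: "'k \<Rightarrow>\<^sub>L 'k \<Rightarrow> 'k \<Rightarrow>\<^sub>L 'k"
  assumes vN: "von_neumann_algebra B"
    and into: "x \<in> B \<Longrightarrow> \<theta> x \<in> B"
    and add: "\<lbrakk>x \<in> B; y \<in> B\<rbrakk> \<Longrightarrow> \<theta> (x + y) = \<theta> x + \<theta> y"
    and scaleC: "x \<in> B \<Longrightarrow> \<theta> (c *\<^sub>C x) = c *\<^sub>C \<theta> x"
    and compose: "\<lbrakk>x \<in> B; y \<in> B\<rbrakk> \<Longrightarrow> \<theta> (x o\<^sub>L y) = \<theta> x o\<^sub>L \<theta> y"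
    and adj: "x \<in> B \<Longrightarrow> \<theta> (adj x) = adj (\<theta> x)"
    and id: "\<theta> id_blinfun = id_blinfun"
begin

lemma subspace: "csubspace B"
  and id_in: "id_blinfun \<in> B"
  and bounded: "x \<in> B \<Longrightarrow> x \<in> bounded_ops"
  and adj_in: "x \<in> B \<Longrightarrow> adj x \<in> B"
  and compose_in: "\<lbrakk>x \<in> B; y \<in> B\<rbrakk> \<Longrightarrow> x o\<^sub>L y \<in> B"
  using vN unfolding von_neumann_algebra_def by blast+

lemmas add_in = complex_vector.subspace_add[OF subspace]
  and diff_in = complex_vector.subspace_diff[OF subspace]
  and scaleC_in = complex_vector.subspace_scale[OF subspace]
  and zero_in = complex_vector.subspace_0[OF subspace]
  and sum_in = complex_vector.subspace_sum[OF subspace]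

lemma scaleR_in: "x \<in> B \<Longrightarrow> r *\<^sub>R x \<in> B"
  using scaleC_in[of x "complex_of_real r"] by (simp add: scaleC_of_real)

lemma scaleR: "x \<in> B \<Longrightarrow> \<theta> (r *\<^sub>R x) = r *\<^sub>R \<theta> x"
  using scaleC[of x "complex_of_real r"] by (simp add: scaleC_of_real)

lemma zero: "\<theta> 0 = 0"
  using scaleR[OF zero_in, of 0] by simp

lemma diff: "\<lbrakk>x \<in> B; y \<in> B\<rbrakk> \<Longrightarrow> \<theta> (x - y) = \<theta> x - \<theta> y"
  using add[of "x - y" y] diff_in[of x y] by simp

lemma sum: "\<lbrakk>\<And>i. i \<in> I \<Longrightarrow> f i \<in> B\<rbrakk> \<Longrightarrow> \<theta> (\<Sum>i\<in>I. f i) = (\<Sum>i\<in>I. \<theta> (f i))"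
  by (induction I rule: infinite_finite_induct) (simp_all add: zero add sum_in)

text \<open>The inverse is the Neumann series \<open>\<Sum>k. a\<^sup>k\<close>; what matters is that it stays in \<open>B\<close>, so that
  \<open>\<theta>\<close> can be applied to it.\<close>

lemma left_inverse_id_minus:
  assumes "a \<in> B" "norm a < 1"
  obtains w where "w \<in> B" "w o\<^sub>L (id_blinfun - a) = id_blinfun"
proof -
  define f where "f k = ((\<lambda>x. x o\<^sub>L a) ^^ k) id_blinfun" for k
  have f_in: "f k \<in> B" for k
    by (induction k) (simp_all add: f_def id_in compose_in assms)
  have norm_f: "norm (f k) \<le> norm a ^ k" for k
  proof (induction k)
    case 0
    show ?case by (simp add: f_def norm_blinfun_id_le)
  next
    case (Suc k)
    have "norm (f (Suc k)) \<le> norm (f k) * norm a"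
      by (simp add: f_def norm_blinfun_compose)
    also have "\<dots> \<le> norm a ^ k * norm a"
      by (intro mult_right_mono Suc) simp
    finally show ?case by (simp add: mult.commute)
  qed
  have summable: "summable f"
    by (rule summable_comparison_test[OF _ summable_geometric[of "norm a"]])
      (use assms norm_f in auto)
  define w where "w = suminf f"
  have "w \<in> B"
  proof (rule closed_sequentially[OF closed_von_neumann_algebra[OF vN]])
    show "(\<lambda>n. \<Sum>k<n. f k) \<longlonglongrightarrow> w"
      unfolding w_def by (rule summable_LIMSEQ[OF summable])
    show "(\<Sum>k<n. f k) \<in> B" for n
      by (intro sum_in f_in)
  qed
  moreover have "w o\<^sub>L a = w - id_blinfun"
  proof -
    have "w o\<^sub>L a = (\<Sum>k. f k o\<^sub>L a)"
      unfolding w_def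
      by (rule bounded_linear.suminf[OF
            bounded_bilinear.bounded_linear_left[OF bounded_bilinear_blinfun_compose] summable])
    also have "\<dots> = (\<Sum>k. f (Suc k))"
      by (simp add: f_def)
    also have "\<dots> = w - id_blinfun"
      unfolding w_def using suminf_split_head[OF summable] by (simp add: f_def)
    finally show ?thesis .
  qed
  then have "w o\<^sub>L (id_blinfun - a) = id_blinfun"
    using bounded_bilinear.diff_right[OF bounded_bilinear_blinfun_compose, of w id_blinfun a]
    by (simp add: blinfun_eqI)
  ultimately show thesis using that by blast
qed

text \<open>If \<open>y = \<theta> x\<close> were longer than \<open>x\<close>, then \<open>1 - x\<^sup>* x / \<parallel>y\<parallel>\<^sup>2\<close> would be invertible in \<open>B\<close>, and so its
  image \<open>1 - y\<^sup>* y / \<parallel>y\<parallel>\<^sup>2\<close> would be bounded below.  But this operator nearly annihilates the vectors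
  at which \<open>y\<close> nearly attains its norm.\<close>

lemma norm_le:
  assumes x: "x \<in> B"
  shows "norm (\<theta> x) \<le> norm x"
proof (rule ccontr)
  assume "\<not> norm (\<theta> x) \<le> norm x"
  then have less: "norm x < norm (\<theta> x)" by simp
  define y where "y = \<theta> x"
  define s where "s = (norm y)\<^sup>2"
  have s: "(norm x)\<^sup>2 < s" "0 < s"
    using less power_strict_mono[of "norm x" "norm y" 2] by (auto simp: y_def s_def)
  define a where "a = inverse s *\<^sub>R (adj x o\<^sub>L x)"
  have a: "a \<in> B" "norm a < 1"
    using s x by (auto simp: a_def scaleR_in compose_in adj_in norm_adj_compose_self bounded
        field_simps)
  then obtain w where w: "w \<in> B" "w o\<^sub>L (id_blinfun - a) = id_blinfun"
    by (rule left_inverse_id_minus)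
  \<comment> \<open>The maximum with \<open>1\<close> ensures \<open>C\<^sup>-\<^sup>2 \<le> 1\<close>, so that the square root below is one of a
    nonnegative number.\<close>
  define C where "C = max 1 (norm (\<theta> w))"
  have y: "y \<in> bounded_ops"
    by (simp add: y_def bounded into x)
  have \<theta>a: "\<theta> a = inverse s *\<^sub>R (adj y o\<^sub>L y)"
    using x by (simp add: a_def y_def scaleR compose adj adj_in compose_in)
  have inv: "\<theta> w o\<^sub>L (id_blinfun - \<theta> a) = id_blinfun"
    using arg_cong[OF w(2), of \<theta>] w(1) a(1)
    by (simp add: compose diff id id_in diff_in)
  have bound: "(norm (y v))\<^sup>2 \<le> s * (1 - inverse (C\<^sup>2)) * (norm v)\<^sup>2" for v
  proof -
    define u where "u = v - inverse s *\<^sub>R adj y (y v)"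
    have "v = \<theta> w u"
      using arg_cong[OF inv, of "\<lambda>f. blinfun_apply f v"]
      by (simp add: u_def \<theta>a blinfun.bilinear_simps)
    then have "norm v \<le> norm (\<theta> w) * norm u"
      by (metis norm_blinfun)
    also have "\<dots> \<le> C * norm u"
      by (intro mult_right_mono) (simp_all add: C_def)
    finally have "(norm v)\<^sup>2 \<le> C\<^sup>2 * (norm u)\<^sup>2"
      using power_mono[of "norm v" "C * norm u" 2] by (simp add: power_mult_distrib)
    then have 1: "inverse (C\<^sup>2) * (norm v)\<^sup>2 \<le> (norm u)\<^sup>2"
      by (simp add: C_def field_simps)
    \<comment> \<open>On the other hand \<open>u\<close> is shorter than \<open>v\<close>, the more so the longer \<open>y v\<close> is.\<close>
    have "norm (adj y (y v)) \<le> norm y * norm (y v)"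
      using norm_blinfun[of "adj y" "y v"] by (simp add: norm_adj y)
    then have "(norm (adj y (y v)))\<^sup>2 \<le> s * (norm (y v))\<^sup>2"
      using power_mono[of "norm (adj y (y v))" "norm y * norm (y v)" 2]
      by (simp add: power_mult_distrib s_def)
    then have "(inverse s)\<^sup>2 * (norm (adj y (y v)))\<^sup>2 \<le> (inverse s)\<^sup>2 * (s * (norm (y v))\<^sup>2)"
      by (rule mult_left_mono) simp
    also have "\<dots> = inverse s * (norm (y v))\<^sup>2"
      using s by (simp add: power2_eq_square field_simps)
    finally have "(inverse s)\<^sup>2 * (norm (adj y (y v)))\<^sup>2 \<le> inverse s * (norm (y v))\<^sup>2" .
    moreover have "(norm u)\<^sup>2 = (norm v)\<^sup>2 - 2 * (inverse s * (norm (y v))\<^sup>2)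
        + (inverse s)\<^sup>2 * (norm (adj y (y v)))\<^sup>2"
    proof -
      define w where "w = adj y (y v)"
      have "v \<bullet> w = (norm (y v))\<^sup>2"
        by (simp add: w_def inner_adj[OF y, symmetric] power2_norm_eq_inner)
      moreover have "u = v - inverse s *\<^sub>R w"
        by (simp add: u_def w_def)
      then have "u \<bullet> u = v \<bullet> v - inverse s * (v \<bullet> w) - inverse s * (v \<bullet> w - inverse s * (w \<bullet> w))"
        by (simp only: inner_diff_left inner_diff_right inner_commute[of w v] inner_scaleR_left
            inner_scaleR_right)
      then have "u \<bullet> u = v \<bullet> v - 2 * (inverse s * (v \<bullet> w)) + (inverse s)\<^sup>2 * (w \<bullet> w)"
        by algebra
      ultimately show ?thesis
        by (simp only: w_def[symmetric] power2_norm_eq_inner)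
    qed
    ultimately have "(norm u)\<^sup>2 \<le> (norm v)\<^sup>2 - inverse s * (norm (y v))\<^sup>2"
      by linarith
    with 1 have "inverse s * (norm (y v))\<^sup>2 \<le> (1 - inverse (C\<^sup>2)) * (norm v)\<^sup>2"
      by (simp add: algebra_simps)
    then show ?thesis
      using s by (simp add: field_simps)
  qed
  define r where "r = 1 - inverse (C\<^sup>2)"
  have r: "0 \<le> r" "r < 1"
    using one_le_power[of C 2] by (simp_all add: r_def C_def inverse_le_1_iff)
  have "norm y \<le> sqrt (s * r)"
  proof (rule norm_blinfun_bound)
    fix v
    have "(norm (y v))\<^sup>2 \<le> (sqrt (s * r) * norm v)\<^sup>2"
      using bound[of v] r(1) s(2) by (simp add: power_mult_distrib flip: r_def)
    then show "norm (y v) \<le> sqrt (s * r) * norm v"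
      by (rule power2_le_imp_le) (use r(1) s(2) in simp)
  qed (use r(1) s(2) in simp)
  then have "s \<le> s * r"
    using power_mono[of "norm y" "sqrt (s * r)" 2] r(1) s(2) by (simp add: s_def)
  moreover have "s * r < s * 1"
    using r(2) s(2) by (rule mult_strict_left_mono)
  ultimately show False by simp
qed

lemma mat_square_in: "X \<in> op_matrices n B \<Longrightarrow> mat_square n X \<in> op_matrices n B"
  by (auto simp: op_matrices_def mat_square_def intro!: sum_in compose_in adj_in)

lemma mat_square_image:
  assumes "X \<in> op_matrices n B" "i < n" "j < n"
  shows "\<theta> (mat_square n X i j) = mat_square n (\<lambda>i j. \<theta> (X i j)) i j"
proof -
  have X: "X k i \<in> B" "X k j \<in> B" if "k < n" for k
    using assms that by (auto simp: op_matrices_def)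
  have "\<theta> (mat_square n X i j) = (\<Sum>k<n. \<theta> (adj (X k i) o\<^sub>L X k j))"
    unfolding mat_square_def by (rule sum) (simp add: X compose_in adj_in)
  also have "\<dots> = mat_square n (\<lambda>i j. \<theta> (X i j)) i j"
    unfolding mat_square_def by (rule sum.cong) (simp_all add: X compose adj_in adj)
  finally show ?thesis .
qed

lemma op_matrices_bounded: "X \<in> op_matrices n B \<Longrightarrow> X \<in> op_matrices n bounded_ops"
  by (simp add: op_matrices_def bounded)

text \<open>A crude bound on the entries loses the factor \<open>n\<^sup>2\<close>.  Replacing \<open>X\<close> by \<open>X\<^sup>* X\<close> squares both norms by the
  \<open>C\<^sup>*\<close>-identity but leaves this factor alone.\<close>

lemma op_matrix_norm_power:
  assumes "X \<in> op_matrices n B"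
  shows "(op_matrix_norm n (\<lambda>i j. \<theta> (X i j))) ^ (2 ^ k) \<le> real (n * n) * op_matrix_norm n X ^ (2 ^ k)"
  using assms
proof (induction k arbitrary: X)
  case 0
  have "op_matrix_norm n (\<lambda>i j. \<theta> (X i j)) \<le> (\<Sum>i<n. \<Sum>j<n. norm (\<theta> (X i j)))"
    by (rule op_matrix_norm_le_sum)
  also have "\<dots> \<le> (\<Sum>i<n. \<Sum>j<n. op_matrix_norm n X)"
    using 0 by (intro sum_mono order_trans[OF norm_le norm_entry_le]) (auto simp: op_matrices_def)
  finally show ?case by simp
next
  case (Suc k)
  have eq: "op_matrix_norm n (\<lambda>i j. \<theta> (mat_square n X i j)) =
      op_matrix_norm n (mat_square n (\<lambda>i j. \<theta> (X i j)))"
    by (intro op_matrix_norm_cong mat_square_image Suc.prems)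
  have "op_matrix_norm n (\<lambda>i j. \<theta> (X i j)) ^ 2 ^ Suc k =
      op_matrix_norm n (\<lambda>i j. \<theta> (mat_square n X i j)) ^ 2 ^ k"
    unfolding eq using Suc.prems
    by (subst op_matrix_norm_square) (auto simp: op_matrices_def bounded into power_mult)
  also have "\<dots> \<le> real (n * n) * op_matrix_norm n (mat_square n X) ^ 2 ^ k"
    by (rule Suc.IH[OF mat_square_in[OF Suc.prems]])
  also have "\<dots> = real (n * n) * op_matrix_norm n X ^ 2 ^ Suc k"
    by (simp add: op_matrix_norm_square op_matrices_bounded Suc.prems power_mult)
  finally show ?case .
qed

text \<open>Taking \<open>2\<^sup>k\<close>-th roots in the previous bound and letting \<open>k\<close> tend to infinity removes the factor.\<close>

lemma op_matrix_norm_le: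
  assumes "X \<in> op_matrices n B"
  shows "op_matrix_norm n (\<lambda>i j. \<theta> (X i j)) \<le> op_matrix_norm n X"
proof (rule ccontr)
  let ?N = "op_matrix_norm n X" and ?M = "op_matrix_norm n (\<lambda>i j. \<theta> (X i j))"
  assume "\<not> ?M \<le> ?N"
  then have less: "?N < ?M" and pos: "0 < ?M"
    using op_matrix_norm_nonneg[of n X] by auto
  have "1 \<le> real (n * n) * (?N / ?M) ^ (2 ^ k)" for k
    using op_matrix_norm_power[OF assms, of k] pos by (simp add: power_divide field_simps)
  moreover have "(\<lambda>k. real (n * n) * (?N / ?M) ^ (2 ^ k)) \<longlonglongrightarrow> real (n * n) * 0"
  proof (intro tendsto_mult tendsto_const)
    have "(\<lambda>m. (?N / ?M) ^ m) \<longlonglongrightarrow> 0"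
      using less pos op_matrix_norm_nonneg[of n X] by (intro LIMSEQ_power_zero) simp
    moreover have "filterlim (\<lambda>k. 2 ^ k :: nat) at_top sequentially"
      by (rule filterlim_subseq) (simp add: strict_mono_def)
    ultimately show "(\<lambda>k. (?N / ?M) ^ (2 ^ k)) \<longlonglongrightarrow> 0"
      by (rule filterlim_compose)
  qed
  ultimately have "1 \<le> real (n * n) * 0"
    by (intro LIMSEQ_le_const) auto
  then show False by simp
qed

end

lemma star_endomorphism_funpow:
  assumes "star_endomorphism B \<theta>"
  shows "star_endomorphism B (\<theta> ^^ m)"
proof -
  interpret star_endomorphism B \<theta> by fact
  show ?thesis
  proof (induction m)
    case 0
    show ?case by unfold_locales (simp_all add: vN)
  next
    case (Suc m)
    then interpret m: star_endomorphism B "\<theta> ^^ m" .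
    show ?case
      by unfold_locales
        (simp_all add: vN into add scaleC compose adj id m.into m.add m.scaleC m.compose m.adj m.id)
  qed
qed


section \<open>Simultaneous recurrence on the unit circle\<close>

text \<open>Dirichlet's theorem yields a positive multiplier \<open>q\<close> bringing all the scaled arguments \<open>t i\<close> close to
  integers.  As it gives no lower bound on \<open>q\<close> beyond positivity, the arguments are multiplied by \<open>N'\<close>
  beforehand, which makes the exponent \<open>q N'\<close> at least \<open>N\<close>.\<close>

lemma simultaneous_recurrence:
  assumes "finite L" "L \<subseteq> sphere (0::complex) 1" "0 < \<epsilon>"
  shows "\<exists>m\<ge>N. \<forall>z\<in>L. cmod (z ^ m - 1) < \<epsilon>"
proof -
  obtain f :: "nat \<Rightarrow> complex" and n where f: "L = f ` {i. i < n}"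
    using finite_imp_nat_seg_image_inj_on[OF assms(1)] by blast
  define N' where "N' = max N 1"
  obtain M :: nat where M: "2 * pi / \<epsilon> < real M"
    using reals_Archimedean2 by blast
  then have M0: "M > 0"
    using assms(3) by (metis divide_pos_pos not_gr_zero of_nat_0 order_less_asym pi_gt_zero
        zero_less_mult_iff zero_less_numeral)
  define t where "t i = Arg (f i) * real N' / (2 * pi)" for i
  obtain q p where q: "0 < q" and qp: "\<And>i. i < n \<Longrightarrow> \<bar>of_int q * t i - of_int (p i)\<bar> < 1 / M"
    using Dirichlet_approx_simult[OF M0, of n t] by metis
  define m where "m = nat q * N'"
  have "m \<ge> N"
  proof -
    have "1 * N' \<le> nat q * N'"
      using q by (intro mult_right_mono) auto
    then show ?thesis by (simp add: m_def N'_def)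
  qed
  moreover have "cmod (z ^ m - 1) < \<epsilon>" if z_in: "z \<in> L" for z
  proof -
    obtain i where i: "i < n" "z = f i"
      using z_in f by auto
    have "cmod z = 1"
      using z_in assms(2) by auto
    then have z: "z = cis (Arg z)"
      by (metis cis_Arg mult_1 norm_eq_zero sgn_eq zero_neq_one of_real_1 div_by_1)
    define s where "s = of_int q * t i - of_int (p i)"
    have "real m * Arg z = 2 * pi * s + 2 * pi * of_int (p i)"
      using q by (simp add: s_def t_def i m_def field_simps)
    then have "z ^ m = cis (2 * pi * s) * cis (2 * pi * of_int (p i))"
      by (subst z) (simp only: Complex.DeMoivre cis_mult)
    also have "cis (2 * pi * of_int (p i)) = 1"
      by (rule cis_multiple_2pi) simp
    finally have "z ^ m - 1 = exp (\<i> * of_real (2 * pi * s)) - 1"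
      by (simp add: cis_conv_exp)
    then have "cmod (z ^ m - 1) = 2 * \<bar>sin (2 * pi * s / 2)\<bar>"
      by (simp only: dist_exp_i_1)
    also have "\<dots> \<le> 2 * \<bar>2 * pi * s / 2\<bar>"
      by (intro mult_left_mono abs_sin_x_le_abs_x) simp
    also have "\<dots> = 2 * pi * \<bar>s\<bar>"
      by (simp add: abs_mult)
    also have "\<dots> < 2 * pi * (1 / M)"
      using qp[OF i(1)] by (intro mult_strict_left_mono) (simp_all add: s_def)
    also have "\<dots> < \<epsilon>"
      using M M0 assms(3) by (simp add: field_simps)
    finally show ?thesis .
  qed
  ultimately show ?thesis by blast
qed

text \<open>The coarsest filter finer than \<open>sequentially\<close> along which the powers of every unimodular number
  tend to \<open>1\<close>.  No single sequence of exponents works for all of the uncountably many such numbers at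
  once, but a filter does; limits along it replace a choice of exponents for each finite set of
  eigenvalues and each error bound.\<close>

definition recurrence_filter :: "nat filter" where
  "recurrence_filter =
    Inf (insert sequentially ((\<lambda>z. filtercomap (\<lambda>m. z ^ m) (nhds 1)) ` sphere (0::complex) 1))"

lemma recurrence_filter_le_sequentially: "recurrence_filter \<le> sequentially"
  unfolding recurrence_filter_def by (rule Inf_lower) simp

lemma tendsto_power_recurrence_filter:
  assumes "cmod z = 1"
  shows "((\<lambda>m. z ^ m) \<longlongrightarrow> 1) recurrence_filter"
  unfolding filterlim_iff_le_filtercomap recurrence_filter_def
  by (rule Inf_lower) (use assms in simp)

text \<open>Only finitely many of the generating filters need to be met simultaneously, and for these the
  simultaneous recurrence gives an actual sequence \<open>r\<close> of exponents.\<close>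

lemma recurrence_filter_neq_bot: "recurrence_filter \<noteq> bot"
proof -
  let ?g = "\<lambda>z::complex. filtercomap (\<lambda>m. z ^ m) (nhds 1)"
  let ?S = "insert sequentially (?g ` sphere 0 1)"
  have "(INF F\<in>?S. F) \<noteq> bot"
  proof (rule INF_filter_not_bot)
    fix X assume X: "X \<subseteq> ?S" "finite X"
    then obtain L where L: "L \<subseteq> sphere 0 1" "finite L" "X - {sequentially} = ?g ` L"
      using finite_subset_image[of "X - {sequentially}" ?g "sphere 0 1"] by auto
    have "\<forall>k. \<exists>m\<ge>k. \<forall>z\<in>L. cmod (z ^ m - 1) < 1 / real (Suc k)"
      by (intro allI simultaneous_recurrence L) simp
    then obtain r where r: "\<And>k. r k \<ge> k"
      and lim: "\<And>k z. z \<in> L \<Longrightarrow> cmod (z ^ r k - 1) < 1 / real (Suc k)"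
      by metis
    have "filtermap r sequentially \<le> F" if F: "F \<in> X" for F
    proof (cases "F = sequentially")
      case True
      then show ?thesis
        using filterlim_at_top_mono[OF filterlim_ident, of r] r by (simp add: filterlim_def)
    next
      case False
      then obtain z where z: "z \<in> L" "F = ?g z"
        using F L(3) by blast
      have "(\<lambda>k. z ^ r k - 1) \<longlonglongrightarrow> 0"
        by (rule tendsto_norm_zero_cancel, rule tendsto_sandwich[OF _ _ tendsto_const LIMSEQ_Suc[OF lim_1_over_n]])
          (use lim[OF z(1)] in \<open>auto intro!: always_eventually less_imp_le\<close>)
      then have "(\<lambda>k. z ^ r k) \<longlonglongrightarrow> 1"
        by (simp add: LIM_zero_iff)
      then show ?thesis
        unfolding z(2) by (simp add: filterlim_iff_le_filtercomap filtermap_le_iff_le_filtercomap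
            filtercomap_filtercomap filterlim_def filtermap_filtermap)
    qed
    then have "filtermap r sequentially \<le> (INF F\<in>X. F)"
      by (rule INF_greatest)
    then show "(INF F\<in>X. F) \<noteq> bot"
      by (metis bot.extremum_uniqueI filtermap_bot_iff sequentially_bot)
  qed
  then show ?thesis by (simp add: recurrence_filter_def)
qed


section \<open>Peripheral spaces of star endomorphisms\<close>

lemma unital_cstar_algebra_operators:
  fixes S :: "('a::complex_hilbert_space \<Rightarrow>\<^sub>L 'a) set"
  assumes sub: "S \<subseteq> bounded_ops" "csubspace S" and "closed S" and "id_blinfun \<in> S"
    and "\<And>x y. \<lbrakk>x \<in> S; y \<in> S\<rbrakk> \<Longrightarrow> x o\<^sub>L y \<in> S" and "\<And>x. x \<in> S \<Longrightarrow> adj x \<in> S"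
  shows "unital_cstar_algebra S (o\<^sub>L) adj"
proof
  have b: "x \<in> S \<Longrightarrow> x \<in> bounded_ops" for x using sub by blast
  show "complete S"
    using assms by (simp add: complete_eq_closed)
  show "\<exists>e\<in>S. \<forall>x\<in>S. e o\<^sub>L x = x \<and> x o\<^sub>L e = x"
    using assms by (intro bexI[of _ id_blinfun]) (auto intro: blinfun_eqI)
  fix x y z :: "'a \<Rightarrow>\<^sub>L 'a" and c
  show "x \<in> S \<Longrightarrow> y \<in> S \<Longrightarrow> z \<in> S \<Longrightarrow> x o\<^sub>L y o\<^sub>L z = x o\<^sub>L (y o\<^sub>L z)"
    by (intro blinfun_eqI) simp
  show "x \<in> S \<Longrightarrow> y \<in> S \<Longrightarrow> z \<in> S \<Longrightarrow> (x + y) o\<^sub>L z = (x o\<^sub>L z) + (y o\<^sub>L z)"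
    by (rule bounded_bilinear.add_left[OF bounded_bilinear_blinfun_compose])
  show "x \<in> S \<Longrightarrow> y \<in> S \<Longrightarrow> z \<in> S \<Longrightarrow> x o\<^sub>L (y + z) = (x o\<^sub>L y) + (x o\<^sub>L z)"
    by (rule bounded_bilinear.add_right[OF bounded_bilinear_blinfun_compose])
  show "x \<in> S \<Longrightarrow> y \<in> S \<Longrightarrow> c *\<^sub>C x o\<^sub>L y = c *\<^sub>C (x o\<^sub>L y)"
    by (intro blinfun_eqI) (simp add: scaleC_blinfun.rep_eq)
  show "x \<in> S \<Longrightarrow> y \<in> S \<Longrightarrow> x o\<^sub>L c *\<^sub>C y = c *\<^sub>C (x o\<^sub>L y)"
    by (intro blinfun_eqI) (simp add: scaleC_blinfun.rep_eq bounded_ops_scaleC b)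
  show "x \<in> S \<Longrightarrow> y \<in> S \<Longrightarrow> norm (x o\<^sub>L y) \<le> norm x * norm y"
    by (rule norm_blinfun_compose)
qed (use assms in \<open>auto simp: adj_adj adj_add adj_scaleC adj_compose norm_adj_compose_self subsetD\<close>)

lemma csubspace_closure:
  fixes S :: "'a::complex_normed_vector set"
  assumes "csubspace S"
  shows "csubspace (closure S)"
  unfolding complex_vector.subspace_def
proof (intro conjI ballI allI)
  show "0 \<in> closure S"
    using complex_vector.subspace_0[OF assms] closure_subset by blast
  fix x assume x: "x \<in> closure S"
  then obtain f where f: "\<And>n. f n \<in> S" "f \<longlonglongrightarrow> x"
    by (auto simp: closure_sequential)
  {
    fix y assume "y \<in> closure S"
    then obtain g where g: "\<And>n. g n \<in> S" "g \<longlonglongrightarrow> y"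
      by (auto simp: closure_sequential)
    show "x + y \<in> closure S"
      unfolding closure_sequential
      by (intro exI[of _ "\<lambda>n. f n + g n"] conjI allI tendsto_add f g
          complex_vector.subspace_add[OF assms])
  }
  fix c :: complex
  have "(\<lambda>n. c *\<^sub>C f n) \<longlonglongrightarrow> c *\<^sub>C x"
    by (intro tendsto_scaleC tendsto_const f)
  then show "c *\<^sub>C x \<in> closure S"
    unfolding closure_sequential
    by (intro exI[of _ "\<lambda>n. c *\<^sub>C f n"] conjI allI complex_vector.subspace_scale[OF assms] f)
qed

lemma funpow_eigenvector:
  assumes "x \<in> M" "f x = c *\<^sub>C x" and "\<And>y a. y \<in> M \<Longrightarrow> f (a *\<^sub>C y) = a *\<^sub>C f y"
  shows "(f ^^ m) x = c ^ m *\<^sub>C x"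
  by (induction m) (simp_all add: assms scaleC_one scaleC_scaleC mult.commute)

context star_endomorphism
begin

lemma peripheral_eigenspan_subset: "peripheral_eigenspan B \<theta> \<subseteq> B"
  unfolding peripheral_eigenspan_def by (rule complex_vector.span_minimal[OF _ subspace]) auto

lemma peripheral_space_subset: "peripheral_space B \<theta> \<subseteq> B"
  unfolding peripheral_space_def
  by (rule closure_minimal[OF peripheral_eigenspan_subset closed_von_neumann_algebra[OF vN]])

lemma csubspace_peripheral_space: "csubspace (peripheral_space B \<theta>)"
  unfolding peripheral_space_def peripheral_eigenspan_def
  by (rule csubspace_closure[OF complex_vector.subspace_span])

text \<open>The product of eigenvectors for \<open>c\<close> and \<open>d\<close> is one for \<open>c d\<close>, which is again unimodular.\<close>

lemma peripheral_eigenspan_compose: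
  assumes "x \<in> peripheral_eigenspan B \<theta>" "y \<in> peripheral_eigenspan B \<theta>"
  shows "x o\<^sub>L y \<in> peripheral_eigenspan B \<theta>"
proof -
  let ?S = "{x \<in> B. \<exists>c. cmod c = 1 \<and> \<theta> x = c *\<^sub>C x}"
  have compose_S: "a o\<^sub>L b \<in> ?S" if "a \<in> ?S" "b \<in> ?S" for a b
  proof -
    obtain c d where "cmod c = 1" "\<theta> a = c *\<^sub>C a" "cmod d = 1" "\<theta> b = d *\<^sub>C b" "a \<in> B" "b \<in> B"
      using \<open>a \<in> ?S\<close> \<open>b \<in> ?S\<close> by blast
    moreover from this have "\<theta> (a o\<^sub>L b) = (c * d) *\<^sub>C (a o\<^sub>L b)"
      by (intro blinfun_eqI)
        (simp add: compose scaleC_blinfun.rep_eq bounded bounded_ops_scaleC scaleC_scaleC)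
    ultimately show ?thesis
      by (auto simp: compose_in norm_mult intro!: exI[of _ "c * d"])
  qed
  have 1: "a o\<^sub>L b \<in> cspan ?S" if a: "a \<in> ?S" and b: "b \<in> cspan ?S" for a b
    using b
  proof (induction rule: complex_vector.span_induct_alt)
    case base
    show ?case by (simp add: complex_vector.span_zero)
  next
    case (step c s t)
    have "a o\<^sub>L (c *\<^sub>C s + t) = c *\<^sub>C (a o\<^sub>L s) + (a o\<^sub>L t)"
      using a by (intro blinfun_eqI)
        (simp add: blinfun.bilinear_simps scaleC_blinfun.rep_eq bounded bounded_ops_scaleC)
    then show ?case
      using step compose_S[OF a] by (simp add: complex_vector.span_add complex_vector.span_scale complex_vector.span_base)
  qed
  have "a o\<^sub>L b \<in> cspan ?S" if a: "a \<in> cspan ?S" and b: "b \<in> cspan ?S" for a b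
    using a
  proof (induction rule: complex_vector.span_induct_alt)
    case base
    show ?case by (simp add: complex_vector.span_zero)
  next
    case (step c s t)
    have "(c *\<^sub>C s + t) o\<^sub>L b = c *\<^sub>C (s o\<^sub>L b) + (t o\<^sub>L b)"
      by (intro blinfun_eqI) (simp add: blinfun.bilinear_simps scaleC_blinfun.rep_eq)
    then show ?case
      using step 1[OF _ b] by (simp add: complex_vector.span_add complex_vector.span_scale)
  qed
  then show ?thesis
    using assms by (simp add: peripheral_eigenspan_def)
qed

lemma peripheral_eigenspan_adj:
  assumes "x \<in> peripheral_eigenspan B \<theta>"
  shows "adj x \<in> peripheral_eigenspan B \<theta>"
proof -
  let ?S = "{x \<in> B. \<exists>c. cmod c = 1 \<and> \<theta> x = c *\<^sub>C x}"
  have adj_S: "adj a \<in> ?S" if a: "a \<in> ?S" for a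
  proof -
    obtain c where "cmod c = 1" "\<theta> a = c *\<^sub>C a" "a \<in> B"
      using a by blast
    then show ?thesis
      by (auto simp: adj_in adj adj_scaleC bounded intro!: exI[of _ "cnj c"])
  qed
  have "x \<in> cspan ?S" using assms by (simp add: peripheral_eigenspan_def)
  then have "x \<in> bounded_ops \<and> adj x \<in> cspan ?S"
  proof (induction rule: complex_vector.span_induct_alt)
    case base
    have "adj (0 :: 'k \<Rightarrow>\<^sub>L 'k) = 0"
      using adj_diff[OF bounded[OF id_in] bounded[OF id_in]] by simp
    then show ?case by (simp add: complex_vector.span_zero bounded zero_in)
  next
    case (step c s t)
    then have s: "s \<in> bounded_ops" by (auto intro: bounded)
    have "c *\<^sub>C s \<in> bounded_ops" "c *\<^sub>C s + t \<in> bounded_ops"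
      using s step complex_vector.subspace_add[OF csubspace_bounded_ops]
        complex_vector.subspace_scale[OF csubspace_bounded_ops] by auto
    then show ?case
      using step s adj_S[of s] complex_vector.span_base[of "adj s" ?S]
      by (simp add: adj_add adj_scaleC complex_vector.span_add complex_vector.span_scale)
  qed
  then show ?thesis by (simp add: peripheral_eigenspan_def)
qed

lemma peripheral_space_compose:
  assumes "x \<in> peripheral_space B \<theta>" "y \<in> peripheral_space B \<theta>"
  shows "x o\<^sub>L y \<in> peripheral_space B \<theta>"
proof -
  obtain f g where "\<And>n. f n \<in> peripheral_eigenspan B \<theta>" "f \<longlonglongrightarrow> x"
    "\<And>n. g n \<in> peripheral_eigenspan B \<theta>" "g \<longlonglongrightarrow> y"
    using assms by (auto simp: peripheral_space_def closure_sequential)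
  then show ?thesis
    unfolding peripheral_space_def closure_sequential
    by (intro exI[of _ "\<lambda>n. f n o\<^sub>L g n"] conjI allI peripheral_eigenspan_compose
        bounded_bilinear.tendsto[OF bounded_bilinear_blinfun_compose])
qed

lemma peripheral_space_adj:
  assumes "x \<in> peripheral_space B \<theta>"
  shows "adj x \<in> peripheral_space B \<theta>"
proof -
  obtain f where f: "\<And>n. f n \<in> peripheral_eigenspan B \<theta>" "f \<longlonglongrightarrow> x"
    using assms by (auto simp: peripheral_space_def closure_sequential)
  have b: "x \<in> bounded_ops" "f n \<in> bounded_ops" for n
    using assms f(1)[of n] peripheral_space_subset peripheral_eigenspan_subset bounded by auto
  have eq: "norm (adj (f n) - adj x) = norm (f n - x)" for n
    unfolding adj_diff[OF b(2,1), symmetric]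
    by (intro norm_adj complex_vector.subspace_diff[OF csubspace_bounded_ops] b)
  have "(\<lambda>n. norm (f n - x)) \<longlonglongrightarrow> 0"
    using f(2) by (simp add: tendsto_norm_zero_iff LIM_zero_iff)
  then have "(\<lambda>n. adj (f n)) \<longlonglongrightarrow> adj x"
    unfolding eq[symmetric] by (simp add: tendsto_norm_zero_iff LIM_zero_iff)
  then show ?thesis
    unfolding peripheral_space_def closure_sequential
    by (intro exI[of _ "\<lambda>n. adj (f n)"] conjI allI peripheral_eigenspan_adj f)
qed

lemma id_in_peripheral_space: "id_blinfun \<in> peripheral_space B \<theta>"
  unfolding peripheral_space_def peripheral_eigenspan_def
  by (intro subsetD[OF closure_subset] complex_vector.span_base)
    (auto simp: id_in id scaleC_one intro!: exI[of _ 1])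

lemma unital_cstar_algebra_peripheral_space:
  "unital_cstar_algebra (peripheral_space B \<theta>) (o\<^sub>L) adj"
  by (intro unital_cstar_algebra_operators csubspace_peripheral_space id_in_peripheral_space
      peripheral_space_compose peripheral_space_adj)
    (use peripheral_space_subset bounded in \<open>auto simp: peripheral_space_def\<close>)

text \<open>Clear for eigenvectors, and inherited by linear combinations.  It passes to norm limits because all
  powers of \<open>\<theta>\<close> are contractive.\<close>

lemma peripheral_recurrence:
  assumes "z \<in> peripheral_space B \<theta>"
  shows "((\<lambda>m. (\<theta> ^^ m) z) \<longlongrightarrow> z) recurrence_filter"
proof -
  interpret pow: star_endomorphism B "\<theta> ^^ m" for m
    by (rule star_endomorphism_funpow) unfold_locales
  let ?R = "{z \<in> B. ((\<lambda>m. (\<theta> ^^ m) z) \<longlongrightarrow> z) recurrence_filter}"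
  have "csubspace ?R"
    unfolding complex_vector.subspace_def
  proof (intro conjI ballI allI)
    fix x c assume x: "x \<in> ?R"
    then have "((\<lambda>m. c *\<^sub>C (\<theta> ^^ m) x) \<longlongrightarrow> c *\<^sub>C x) recurrence_filter"
      by (intro tendsto_scaleC tendsto_const) simp
    then show "c *\<^sub>C x \<in> ?R"
      using x by (simp add: scaleC_in pow.scaleC)
  qed (auto simp: zero_in pow.zero add_in pow.add intro: tendsto_add)
  moreover have "{x \<in> B. \<exists>c. cmod c = 1 \<and> \<theta> x = c *\<^sub>C x} \<subseteq> ?R"
  proof safe
    fix x c assume x: "x \<in> B" "cmod c = 1" "\<theta> x = c *\<^sub>C x"
    have "((\<lambda>m. c ^ m *\<^sub>C x) \<longlongrightarrow> 1 *\<^sub>C x) recurrence_filter"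
      by (intro tendsto_scaleC tendsto_power_recurrence_filter tendsto_const x)
    then show "((\<lambda>m. (\<theta> ^^ m) x) \<longlongrightarrow> x) recurrence_filter"
      using funpow_eigenvector[of x B \<theta> c] x scaleC by (simp add: scaleC_one)
  qed
  ultimately have span: "peripheral_eigenspan B \<theta> \<subseteq> ?R"
    unfolding peripheral_eigenspan_def by (rule complex_vector.span_minimal[rotated])
  show ?thesis
  proof (rule tendstoI)
    fix e :: real assume e: "e > 0"
    then obtain y where y: "y \<in> peripheral_eigenspan B \<theta>" "dist y z < e / 3"
      using assms unfolding peripheral_space_def closure_approachable
      by (meson divide_pos_pos zero_less_numeral)
    have B: "y \<in> B" "z \<in> B"
      using y assms peripheral_eigenspan_subset peripheral_space_subset by auto
    have "((\<lambda>m. (\<theta> ^^ m) y) \<longlongrightarrow> y) recurrence_filter"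
      using span y by auto
    then have "\<forall>\<^sub>F m in recurrence_filter. dist ((\<theta> ^^ m) y) y < e / 3"
      using e by (intro tendstoD) auto
    then show "\<forall>\<^sub>F m in recurrence_filter. dist ((\<theta> ^^ m) z) z < e"
    proof eventually_elim
      case (elim m)
      have "dist ((\<theta> ^^ m) z) ((\<theta> ^^ m) y) \<le> dist z y"
        using pow.norm_le[of "z - y" m] B by (simp add: dist_norm pow.diff diff_in)
      moreover have "dist ((\<theta> ^^ m) z) z
          \<le> dist ((\<theta> ^^ m) z) ((\<theta> ^^ m) y) + (dist ((\<theta> ^^ m) y) y + dist y z)"
        by (meson dist_triangle dist_triangle_le add_left_mono order_trans)
      ultimately show ?case
        using elim y(2) by (simp add: dist_commute)
    qed
  qed
qed

end


section \<open>Strong limits along increasing projections\<close>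

text \<open>The analogue of the convergence of bounded martingales.  For \<open>x\<close> in the range of \<open>p\<^sub>N\<close> and
  \<open>N \<le> m \<le> m'\<close> the vector \<open>z\<^sub>m x\<close> is the projection of \<open>z\<^sub>m\<^sub>' x\<close> by \<open>p\<^sub>m\<close>.  By Pythagoras the squared
  norms increase, and their increments are the squared distances, so boundedness makes the sequence
  Cauchy.  These \<open>x\<close> are dense.\<close>

lemma increasing_projections_limit:
  fixes p z :: "nat \<Rightarrow> 'k::{real_inner,banach} \<Rightarrow>\<^sub>L 'k"
  assumes self: "\<And>n u v. p n u \<bullet> v = u \<bullet> p n v"
    and mono: "\<And>n m v. n \<le> m \<Longrightarrow> p m (p n v) = p n v"
    and lim: "\<And>v. (\<lambda>n. p n v) \<longlonglongrightarrow> v"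
    and norm_z: "\<And>n. norm (z n) \<le> C"
    and compress: "\<And>n m v. n \<le> m \<Longrightarrow> p n (z m (p n v)) = z n v"
  obtains w :: "'k \<Rightarrow>\<^sub>L 'k"
  where "\<And>v. (\<lambda>n. z n v) \<longlonglongrightarrow> w v" "\<And>n v. p n (w (p n v)) = z n v"
proof -
  have norm_zv: "norm (z n v) \<le> C * norm v" for n v
    by (rule order_trans[OF norm_blinfun mult_right_mono[OF norm_z norm_ge_zero]])
  have Cauchy_range: "Cauchy (\<lambda>m. z m (p N v))" for N v
  proof -
    define x where "x = p N v"
    have z_eq: "z m x = p m (z m' x)" if "N \<le> m" "m \<le> m'" for m m'
      using compress[OF that(2), of x] mono[OF that(1), of v] by (simp add: x_def)
    have pythagoras: "(norm (z m' x - z m x))\<^sup>2 = (norm (z m' x))\<^sup>2 - (norm (z m x))\<^sup>2"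
      if "N \<le> m" "m \<le> m'" for m m'
    proof -
      define u where "u = z m' x"
      have "p m u \<bullet> p m u = u \<bullet> p m u"
        by (simp add: self mono)
      then show ?thesis
        unfolding z_eq[OF that] u_def[symmetric]
        by (simp add: power2_norm_eq_inner inner_diff_left inner_diff_right inner_commute[of "p m u" u])
    qed
    define a where "a k = (norm (z (k + N) x))\<^sup>2" for k
    have "incseq a"
    proof (rule incseq_SucI)
      show "a k \<le> a (Suc k)" for k
        using pythagoras[of "k + N" "Suc k + N"] zero_le_power2[of "norm (z (Suc k + N) x - z (k + N) x)"]
        by (simp add: a_def)
    qed
    moreover have "Bseq a"
      by (rule BseqI'[of _ "(C * norm x)\<^sup>2"]) (simp add: a_def norm_zv power_mono)
    ultimately have "Cauchy a"
      by (intro convergent_Cauchy Bseq_monoseq_convergent) (simp_all add: monoseq_iff)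
    show ?thesis
      unfolding x_def[symmetric]
    proof (rule metric_CauchyI)
      fix e :: real assume e: "0 < e"
      then obtain M where M: "\<And>k l. k \<ge> M \<Longrightarrow> l \<ge> M \<Longrightarrow> dist (a k) (a l) < e\<^sup>2"
        using metric_CauchyD[OF \<open>Cauchy a\<close>, of "e\<^sup>2"] by auto
      have less: "dist (z m' x) (z m x) < e" if "M + N \<le> m" "m \<le> m'" for m m'
      proof -
        have "(norm (z m' x - z m x))\<^sup>2 = a (m' - N) - a (m - N)"
          using that by (subst pythagoras) (auto simp: a_def)
        also have "\<dots> < e\<^sup>2"
          using M[of "m' - N" "m - N"] that by (simp add: dist_real_def le_diff_conv2)
        finally show ?thesis
          unfolding dist_norm using e by (meson less_imp_le power2_less_imp_less)
      qed
      show "\<exists>M. \<forall>m\<ge>M. \<forall>n\<ge>M. dist (z m x) (z n x) < e"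
      proof (intro exI allI impI)
        fix m n assume "M + N \<le> m" "M + N \<le> n"
        then show "dist (z m x) (z n x) < e"
          using less[of m n] less[of n m] by (cases "m \<le> n") (auto simp: dist_commute)
      qed
    qed
  qed
  have "Cauchy (\<lambda>m. z m v)" for v
  proof (rule metric_CauchyI)
    fix e :: real assume e: "0 < e"
    have "(\<lambda>N. C * norm (v - p N v)) \<longlonglongrightarrow> C * norm (v - v)"
      by (intro tendsto_intros lim)
    then have "\<forall>\<^sub>F N in sequentially. C * norm (v - p N v) < e / 3"
      using e by (intro order_tendstoD) auto
    then obtain N where N: "C * norm (v - p N v) < e / 3"
      by (auto simp: eventually_sequentially)
    have near: "dist (z m v) (z m (p N v)) < e / 3" for m
      using norm_zv[of m "v - p N v"] N by (simp add: dist_norm blinfun.diff_right)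
    obtain M where M: "\<And>m n. m \<ge> M \<Longrightarrow> n \<ge> M \<Longrightarrow> dist (z m (p N v)) (z n (p N v)) < e / 3"
      using metric_CauchyD[OF Cauchy_range, of "e / 3" N v] e by auto
    have "dist (z m v) (z n v) < e" if "m \<ge> M" "n \<ge> M" for m n
      using near[of m] near[of n] M[OF that]
        dist_triangle[of "z m v" "z n v" "z m (p N v)"]
        dist_triangle[of "z m (p N v)" "z n v" "z n (p N v)"]
      by (simp add: dist_commute)
    then show "\<exists>M. \<forall>m\<ge>M. \<forall>n\<ge>M. dist (z m v) (z n v) < e" by blast
  qed
  then have "\<exists>l. (\<lambda>m. z m v) \<longlonglongrightarrow> l" for v
    using Cauchy_convergent convergent_def by blast
  then obtain g where g: "\<And>v. (\<lambda>m. z m v) \<longlonglongrightarrow> g v" by metis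
  have "bounded_linear g"
  proof (rule bounded_linear_intro[where K = C])
    show "g (x + y) = g x + g y" for x y
      using tendsto_add[OF g[of x] g[of y]]
      by (intro LIMSEQ_unique[OF g]) (simp add: blinfun.add_right)
    show "g (r *\<^sub>R x) = r *\<^sub>R g x" for r x
      using tendsto_scaleR[OF tendsto_const[of r] g[of x]]
      by (intro LIMSEQ_unique[OF g]) (simp add: blinfun.scaleR_right)
    show "norm (g x) \<le> norm x * C" for x
      by (rule Lim_bounded[OF tendsto_norm[OF g], of 0]) (simp add: norm_zv mult.commute)
  qed
  then have app: "blinfun_apply (Blinfun g) = g"
    by (rule bounded_linear_Blinfun_apply)
  show thesis
  proof (rule that[of "Blinfun g"])
    show "(\<lambda>n. z n v) \<longlonglongrightarrow> Blinfun g v" for v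
      using g by (simp add: app)
    show "p n (Blinfun g (p n v)) = z n v" for n v
    proof (rule LIMSEQ_unique[rotated])
      have "\<forall>\<^sub>F m in sequentially. p n (z m (p n v)) = z n v"
        using eventually_ge_at_top[of n] by eventually_elim (rule compress)
      then show "(\<lambda>m. p n (z m (p n v))) \<longlonglongrightarrow> z n v"
        by (rule tendsto_eventually)
      show "(\<lambda>m. p n (z m (p n v))) \<longlonglongrightarrow> p n (Blinfun g (p n v))"
        unfolding app by (intro tendsto_intros g)
    qed
  qed
qed


section \<open>The increasing projections of a minimal dilation\<close>

locale dilation =
  fixes A :: "('h::complex_hilbert_space \<Rightarrow>\<^sub>L 'h) set" and \<tau>
    and V :: "'h \<Rightarrow>\<^sub>L 'k::complex_hilbert_space" and B :: "('k \<Rightarrow>\<^sub>L 'k) set" and \<theta>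
  assumes vN_A: "von_neumann_algebra A" and ucp: "normal_ucp_map A \<tau>"
    and dil: "minimal_dilation A \<tau> V B \<theta>"
begin

sublocale theta: star_endomorphism B \<theta>
proof -
  have "von_neumann_algebra B" and "normal_unital_star_endomorphism B \<theta>"
    using dil unfolding minimal_dilation_def by blast+
  then show "star_endomorphism B \<theta>"
    unfolding normal_unital_star_endomorphism_def clinear_on_def star_endomorphism_def Pi_iff
    by blast
qed

sublocale pow: star_endomorphism B "\<theta> ^^ m" for m
  by (rule star_endomorphism_funpow[OF theta.star_endomorphism_axioms])

lemma V_bounded: "V \<in> bounded_ops" and norm_V: "norm (V h) = norm h"
  and A_eq: "A = compress_op V ` B"
  and tau_funpow: "x \<in> A \<Longrightarrow> (\<tau> ^^ n) x = compress_op V ((\<theta> ^^ n) (extend_op V x))"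
  and minimal: "closure (cspan {dilation_vector V \<theta> x h n | x h n. \<forall>i\<in>{1..n}. x i \<in> A}) = UNIV"
  and B_eq: "B = generated_von_neumann_algebra {(\<theta> ^^ n) (extend_op V x) | n x. x \<in> A}"
  using dil unfolding minimal_dilation_def hilbert_embedding_def by blast+

lemma inner_V: "V g \<bullet> V h = g \<bullet> h"
  by (simp add: dot_norm norm_V flip: blinfun.add_right)

lemma adj_V_V: "adj V (V h) = h"
  by (rule vector_eq_ldot[THEN iffD1]) (simp add: inner_V V_bounded flip: inner_adj)

lemma norm_V_le: "norm V \<le> 1" and norm_adj_V_le: "norm (adj V) \<le> 1"
proof -
  show "norm V \<le> 1"
    by (rule norm_blinfun_bound) (simp_all add: norm_V)
  then show "norm (adj V) \<le> 1"
    by (simp add: norm_adj V_bounded)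
qed

lemma compress_extend: "compress_op V (extend_op V x) = x"
  by (intro blinfun_eqI) (simp add: compress_op_def extend_op_def adj_V_V)

lemma extend_in: "x \<in> A \<Longrightarrow> extend_op V x \<in> B"
proof -
  assume "x \<in> A"
  then have "(\<theta> ^^ 0) (extend_op V x) \<in> {(\<theta> ^^ n) (extend_op V x) | n x. x \<in> A}"
    by blast
  also have "\<dots> \<subseteq> B"
    by (subst B_eq) (unfold generated_von_neumann_algebra_def, blast)
  finally show "extend_op V x \<in> B" by simp
qed

lemma compress_in: "z \<in> B \<Longrightarrow> compress_op V z \<in> A"
  by (simp add: A_eq)

lemma id_in_A: "id_blinfun \<in> A"
  using vN_A unfolding von_neumann_algebra_def by blast

lemma tau_id: "\<tau> id_blinfun = id_blinfun"
  and tau_scaleC: "x \<in> A \<Longrightarrow> \<tau> (c *\<^sub>C x) = c *\<^sub>C \<tau> x"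
  using ucp unfolding normal_ucp_map_def completely_positive_on_def clinear_on_def by blast+

lemma tau_funpow_id: "(\<tau> ^^ n) id_blinfun = id_blinfun"
  by (induction n) (simp_all add: tau_id)

text \<open>Since \<open>extend_op V\<close> maps the identity to \<open>p = V V\<^sup>*\<close>, this is \<open>\<theta>\<^sup>m(p)\<close>.\<close>

definition proj :: "nat \<Rightarrow> 'k \<Rightarrow>\<^sub>L 'k" where
  "proj m = (\<theta> ^^ m) (extend_op V id_blinfun)"

lemma proj_in: "proj m \<in> B"
  by (simp add: proj_def pow.into extend_in id_in_A)

lemma proj_0: "proj 0 v = V (adj V v)"
  by (simp add: proj_def extend_op_def)

lemma proj_idem: "proj m (proj m v) = proj m v"
proof -
  have "proj 0 o\<^sub>L proj 0 = proj 0"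
    by (intro blinfun_eqI) (simp add: proj_0 adj_V_V)
  then have "proj m o\<^sub>L proj m = proj m"
    using pow.compose[OF proj_in[of 0] proj_in[of 0], of m] by (simp add: proj_def)
  then show ?thesis by (metis blinfun_apply_blinfun_compose)
qed

lemma proj_self: "proj m u \<bullet> v = u \<bullet> proj m v"
proof -
  have "adj (proj 0) = proj 0"
    using pow.bounded[OF proj_in]
    by (intro adj_eqI) (simp_all add: proj_0 V_bounded inner_adj inner_adj'[symmetric] inner_V adj_V_V)
  then have "adj (proj m) = proj m"
    using pow.adj[OF proj_in[of 0], of m] by (simp add: proj_def)
  then show ?thesis
    using inner_adj[OF pow.bounded[OF proj_in]] by metis
qed

lemma norm_proj_diff: "(norm (v - proj m v))\<^sup>2 = v \<bullet> v - v \<bullet> proj m v"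
  using proj_self[of m v "proj m v"]
  by (simp add: power2_norm_eq_inner inner_diff_left inner_diff_right proj_idem inner_commute[of "proj m v" v])

text \<open>The dilation property at the identity and \<open>\<tau>(1) = 1\<close> give \<open>\<langle>V h, p\<^sub>m V h\<rangle> = \<parallel>h\<parallel>\<^sup>2\<close>, so that \<open>p\<^sub>m\<close> does
  not shorten \<open>V h\<close>, which for a projection means that it fixes it.\<close>

lemma proj_V: "proj m (V h) = V h"
proof -
  have "adj V (proj m (V h)) = h"
    using tau_funpow[OF id_in_A, of m] unfolding tau_funpow_id proj_def[symmetric] compress_op_def
    by (metis blinfun_apply_blinfun_compose blinfun_apply_id_blinfun id_apply)
  then have "V h \<bullet> proj m (V h) = h \<bullet> h"
    by (simp add: inner_adj V_bounded)
  then have "(norm (V h - proj m (V h)))\<^sup>2 = 0"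
    unfolding norm_proj_diff by (simp add: inner_V)
  then show ?thesis by simp
qed

lemma adj_V_proj: "adj V (proj m v) = adj V v"
  by (rule vector_eq_ldot[THEN iffD1])
    (simp add: V_bounded proj_V flip: inner_adj proj_self)

text \<open>This is the inclusion \<open>p \<le> p\<^sub>m\<^sub>-\<^sub>n\<close> of the previous lemmas, mapped by \<open>\<theta>\<^sup>n\<close>.\<close>

lemma proj_mono:
  assumes "n \<le> m"
  shows "proj m (proj n v) = proj n v"
proof -
  have eq: "proj (m - n) o\<^sub>L proj 0 = proj 0"
    by (intro blinfun_eqI) (simp add: proj_0 proj_V)
  have "(\<theta> ^^ n) (proj k) = proj (n + k)" for k
    by (simp add: proj_def funpow_add)
  then have "proj m o\<^sub>L proj n = proj n"
    using arg_cong[OF eq, of "\<theta> ^^ n"] assms by (simp add: pow.compose proj_in)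
  then show ?thesis by (metis blinfun_apply_blinfun_compose)
qed

lemma norm_proj_le: "norm (proj m) \<le> 1"
proof (rule norm_blinfun_bound)
  fix v
  have "(norm (proj m v))\<^sup>2 = v \<bullet> proj m v"
    by (simp add: power2_norm_eq_inner proj_self proj_idem)
  then have "(norm (proj m v))\<^sup>2 \<le> (norm v)\<^sup>2"
    using norm_proj_diff[of v m] zero_le_power2[of "norm (v - proj m v)"]
    by (simp add: power2_norm_eq_inner)
  then have "norm (proj m v) \<le> norm v"
    by (rule power2_le_imp_le) simp
  then show "norm (proj m v) \<le> 1 * norm v" by simp
qed simp

text \<open>Apply \<open>\<theta>\<^sup>m\<close> to \<open>p z p\<close>.\<close>

lemma compress_funpow_between:
  assumes "z \<in> B"
  shows "proj m o\<^sub>L (\<theta> ^^ m) z o\<^sub>L proj m = (\<theta> ^^ m) (extend_op V (compress_op V z))"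
proof -
  have "proj 0 o\<^sub>L z o\<^sub>L proj 0 = extend_op V (compress_op V z)"
    by (intro blinfun_eqI) (simp add: proj_0 extend_op_def compress_op_def)
  then have "(\<theta> ^^ m) (extend_op V (compress_op V z)) =
      (\<theta> ^^ m) (proj 0) o\<^sub>L (\<theta> ^^ m) z o\<^sub>L (\<theta> ^^ m) (proj 0)"
    using assms by (metis pow.compose pow.compose_in proj_in)
  then show ?thesis by (simp add: proj_def)
qed

text \<open>The dilation property speaks only of operators \<open>V x V\<^sup>*\<close>.  It extends to all of \<open>B\<close> because
  \<open>p \<le> p\<^sub>m\<close>, so that the compression only sees \<open>p\<^sub>m \<theta>\<^sup>m(z) p\<^sub>m\<close>.\<close>

lemma compress_funpow:
  assumes "z \<in> B"
  shows "compress_op V ((\<theta> ^^ m) z) = (\<tau> ^^ m) (compress_op V z)"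
proof -
  have "compress_op V ((\<theta> ^^ m) z) = compress_op V (proj m o\<^sub>L (\<theta> ^^ m) z o\<^sub>L proj m)"
    by (intro blinfun_eqI) (simp add: compress_op_def adj_V_proj proj_V)
  also have "\<dots> = (\<tau> ^^ m) (compress_op V z)"
    using assms by (simp add: compress_funpow_between tau_funpow compress_in)
  finally show ?thesis .
qed

lemma compress_add: "compress_op V (x + y) = compress_op V x + compress_op V y"
  and compress_scaleC: "compress_op V (c *\<^sub>C x) = c *\<^sub>C compress_op V x"
  and compress_diff: "compress_op V (x - y) = compress_op V x - compress_op V y"
  by (intro blinfun_eqI; simp add: compress_op_def blinfun.bilinear_simps scaleC_blinfun.rep_eq
      bounded_ops_scaleC[OF adj_bounded_ops[OF V_bounded]])+

lemma compress_adj: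
  assumes "x \<in> bounded_ops"
  shows "compress_op V (adj x) = adj (compress_op V x)"
  using assms V_bounded
  by (intro adj_eqI[symmetric])
    (simp_all add: compress_op_def bounded_ops_compose adj_bounded_ops adj_adj inner_adj)

lemma norm_compress_le: "norm (compress_op V x) \<le> norm x"
  using op_matrix_norm_compress[OF norm_adj_V_le norm_V_le, of 1 "\<lambda>_ _. x"]
  by (simp add: op_matrix_norm_1 compress_op_def flip: One_nat_def)

text \<open>The outermost factor \<open>\<theta>\<^sup>n(V x V\<^sup>*)\<close> has its range in that of \<open>p\<^sub>n\<close>.\<close>

lemma proj_dilation_vector:
  assumes "\<forall>i\<in>{1..n}. x i \<in> A" "n \<le> m"
  shows "proj m (dilation_vector V \<theta> x h n) = dilation_vector V \<theta> x h n"
proof (cases n)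
  case 0
  then show ?thesis by (simp add: proj_V)
next
  case (Suc k)
  have x: "extend_op V (x n) \<in> B"
    using assms Suc by (auto intro: extend_in)
  have "proj 0 o\<^sub>L extend_op V (x n) = extend_op V (x n)"
    by (intro blinfun_eqI) (simp add: proj_0 extend_op_def adj_V_V)
  then have "proj n o\<^sub>L (\<theta> ^^ n) (extend_op V (x n)) = (\<theta> ^^ n) (extend_op V (x n))"
    using pow.compose[OF proj_in[of 0] x, of n] by (simp add: proj_def)
  then have "proj n (dilation_vector V \<theta> x h n) = dilation_vector V \<theta> x h n"
    unfolding Suc dilation_vector.simps by (metis blinfun_apply_blinfun_compose)
  then show ?thesis
    using proj_mono[OF assms(2)] by metis
qed

text \<open>The vectors \<open>v\<close> with \<open>p\<^sub>m v \<longlonglongrightarrow> v\<close> form a subspace, closed since the \<open>p\<^sub>m\<close> are contractions, and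
  every dilation vector is eventually fixed.\<close>

lemma proj_tendsto: "(\<lambda>m. proj m v) \<longlonglongrightarrow> v"
proof -
  let ?S = "{v. (\<lambda>m. proj m v) \<longlonglongrightarrow> v}"
  have "csubspace ?S"
    unfolding complex_vector.subspace_def
  proof (intro conjI ballI allI)
    fix x c assume "x \<in> ?S"
    then have "(\<lambda>m. c *\<^sub>C proj m x) \<longlonglongrightarrow> c *\<^sub>C x"
      by (intro tendsto_scaleC tendsto_const) simp
    then show "c *\<^sub>C x \<in> ?S"
      by (simp add: bounded_ops_scaleC[OF pow.bounded[OF proj_in]])
  qed (auto simp: blinfun.add_right intro: tendsto_add)
  moreover have "{dilation_vector V \<theta> x h n | x h n. \<forall>i\<in>{1..n}. x i \<in> A} \<subseteq> ?S"
  proof safe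
    fix x :: "nat \<Rightarrow> 'h \<Rightarrow>\<^sub>L 'h" and h n assume x: "\<forall>i\<in>{1..n}. x i \<in> A"
    have "\<forall>\<^sub>F m in sequentially. proj m (dilation_vector V \<theta> x h n) = dilation_vector V \<theta> x h n"
      using eventually_ge_at_top[of n] by eventually_elim (rule proj_dilation_vector[OF x])
    then show "(\<lambda>m. proj m (dilation_vector V \<theta> x h n)) \<longlonglongrightarrow> dilation_vector V \<theta> x h n"
      by (rule tendsto_eventually)
  qed
  ultimately have span: "cspan {dilation_vector V \<theta> x h n | x h n. \<forall>i\<in>{1..n}. x i \<in> A} \<subseteq> ?S"
    by (rule complex_vector.span_minimal[rotated])
  show ?thesis
  proof (rule tendstoI)
    fix e :: real assume e: "e > 0"
    have "v \<in> closure (cspan {dilation_vector V \<theta> x h n | x h n. \<forall>i\<in>{1..n}. x i \<in> A})"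
      unfolding minimal by simp
    then obtain u where u: "u \<in> ?S" "dist u v < e / 3"
      using span e unfolding closure_approachable by (meson divide_pos_pos subsetD zero_less_numeral)
    then have "\<forall>\<^sub>F m in sequentially. dist (proj m u) u < e / 3"
      using e by (intro tendstoD) auto
    then show "\<forall>\<^sub>F m in sequentially. dist (proj m v) v < e"
    proof eventually_elim
      case (elim m)
      have "dist (proj m v) (proj m u) \<le> norm (proj m) * dist v u"
        using norm_blinfun[of "proj m" "v - u"] by (simp add: dist_norm blinfun.diff_right)
      also have "\<dots> \<le> 1 * dist v u"
        by (intro mult_right_mono norm_proj_le) simp
      finally show ?case
        using elim u(2) dist_triangle[of "proj m v" v "proj m u"] dist_triangle[of "proj m u" v u]
        by (simp add: dist_commute)
    qed
  qed
qed

lemma proj_tendsto_compose: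
  assumes F: "F \<le> sequentially" and u: "(u \<longlongrightarrow> l) F"
  shows "((\<lambda>m. proj m (u m)) \<longlongrightarrow> l) F"
proof -
  have "((\<lambda>m. norm (u m - l)) \<longlongrightarrow> 0) F"
    using u by (simp add: tendsto_norm_zero_iff LIM_zero_iff)
  moreover have "norm (proj m (u m - l)) \<le> norm (norm (u m - l)) * 1" for m
    using norm_blinfun[of "proj m" "u m - l"] mult_right_mono[OF norm_proj_le[of m], of "norm (u m - l)"]
    by simp
  then have "\<forall>\<^sub>F m in F. norm (proj m (u m - l)) \<le> norm (norm (u m - l)) * 1"
    by (intro always_eventually allI)
  ultimately have "((\<lambda>m. proj m (u m - l)) \<longlongrightarrow> 0) F"
    by (rule tendsto_0_le)
  moreover have "((\<lambda>m. proj m l) \<longlongrightarrow> l) F"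
    using proj_tendsto F by (rule tendsto_mono[rotated])
  ultimately have "((\<lambda>m. proj m (u m - l) + proj m l) \<longlongrightarrow> 0 + l) F"
    by (rule tendsto_add)
  then show ?thesis by (simp add: blinfun.diff_right)
qed


section \<open>Compression of the peripheral space\<close>

text \<open>For the lower bound, the corner \<open>p\<^sub>m \<theta>\<^sup>m(X) p\<^sub>m = \<theta>\<^sup>m(p X p)\<close> is no larger than the compression of
  \<open>X\<close>, and along the recurrence filter it converges strongly to \<open>X\<close>: the projections tend to \<open>1\<close> and
  \<open>\<theta>\<^sup>m(X)\<close> returns to \<open>X\<close>.\<close>

lemma op_matrix_norm_compress_eq:
  assumes X: "X \<in> op_matrices n (peripheral_space B \<theta>)"
  shows "op_matrix_norm n (\<lambda>i j. compress_op V (X i j)) = op_matrix_norm n X"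
proof (rule antisym)
  let ?N = "op_matrix_norm n (\<lambda>i j. compress_op V (X i j))"
  show "?N \<le> op_matrix_norm n X"
    unfolding compress_op_def by (rule op_matrix_norm_compress[OF norm_adj_V_le norm_V_le])
  have X_in: "X i j \<in> peripheral_space B \<theta>" "X i j \<in> B" if "i < n" "j < n" for i j
    using X that theta.peripheral_space_subset by (auto simp: op_matrices_def)
  let ?Y = "\<lambda>m i j. proj m o\<^sub>L (\<theta> ^^ m) (X i j) o\<^sub>L proj m"
  have Y_le: "op_matrix_norm n (?Y m) \<le> ?N" for m
  proof -
    have "op_matrix_norm n (?Y m) =
        op_matrix_norm n (\<lambda>i j. (\<theta> ^^ m) (extend_op V (compress_op V (X i j))))"
      by (intro op_matrix_norm_cong compress_funpow_between X_in)
    also have "\<dots> \<le> op_matrix_norm n (\<lambda>i j. extend_op V (compress_op V (X i j)))"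
      by (rule pow.op_matrix_norm_le) (auto simp: op_matrices_def X_in intro!: extend_in compress_in)
    also have "\<dots> \<le> ?N"
      unfolding extend_op_def by (rule op_matrix_norm_compress[OF norm_V_le norm_adj_V_le])
    finally show ?thesis .
  qed
  show "op_matrix_norm n X \<le> ?N"
  proof (rule op_matrix_norm_least[OF op_matrix_norm_nonneg])
    fix v :: "nat \<Rightarrow> 'k"
    have "((\<lambda>m. ?Y m i j (v j)) \<longlongrightarrow> X i j (v j)) recurrence_filter" if "i < n" "j < n" for i j
      unfolding blinfun_apply_blinfun_compose
      by (intro proj_tendsto_compose recurrence_filter_le_sequentially
          bounded_bilinear.tendsto[OF bounded_bilinear_blinfun_apply]
          theta.peripheral_recurrence X_in that tendsto_const)
    then have "((\<lambda>m. tuple_norm n (mat_apply n (?Y m) v)) \<longlongrightarrow> tuple_norm n (mat_apply n X v)) recurrence_filter"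
      unfolding tuple_norm_def mat_apply_def L2_set_def
      by (intro tendsto_real_sqrt tendsto_sum tendsto_power tendsto_norm) auto
    moreover have "tuple_norm n (mat_apply n (?Y m) v) \<le> ?N * tuple_norm n v" for m
      by (rule order_trans[OF tuple_norm_mat_apply_le mult_right_mono[OF Y_le tuple_norm_nonneg]])
    ultimately show "tuple_norm n (mat_apply n X v) \<le> ?N * tuple_norm n v"
      by (intro tendsto_upperbound[OF _ _ recurrence_filter_neq_bot]) auto
  qed
qed

lemma norm_compress_eq:
  assumes "z \<in> peripheral_space B \<theta>"
  shows "norm (compress_op V z) = norm z"
  using op_matrix_norm_compress_eq[of "\<lambda>_ _. z" 1] assms
  by (simp add: op_matrices_def op_matrix_norm_1 flip: One_nat_def)

text \<open>The lift \<open>w\<close> is the strong limit of \<open>z\<^sub>n = c\<^sup>-\<^sup>n \<theta>\<^sup>n(V x V\<^sup>*)\<close>, whose corners are \<open>p\<^sub>n w p\<^sub>n = z\<^sub>n\<close>.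
  Applying \<open>\<theta>\<close> to this identity shows that \<open>\<theta>(w)\<close> and \<open>c w\<close> have the same corners
  \<open>\<theta>(z\<^sub>n) = c z\<^sub>n\<^sub>+\<^sub>1\<close>, and the corners determine an operator because the \<open>p\<^sub>n\<close> tend to \<open>1\<close>.\<close>

lemma eigenvector_lift:
  assumes x: "x \<in> A" and c: "cmod c = 1" and eig: "\<tau> x = c *\<^sub>C x"
  obtains w where "w \<in> B" "\<theta> w = c *\<^sub>C w" "compress_op V w = x"
proof -
  define z where "z n = inverse c ^ n *\<^sub>C (\<theta> ^^ n) (extend_op V x)" for n
  have c0: "c \<noteq> 0" using c by auto
  have z_in: "z n \<in> B" for n
    by (simp add: z_def theta.scaleC_in pow.into extend_in x)
  have norm_z: "norm (z n) \<le> norm (extend_op V x)" for n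
    by (simp add: z_def norm_scaleC norm_power norm_inverse c pow.norm_le extend_in x)
  have z_0: "z 0 = extend_op V x"
    by (simp add: z_def scaleC_one)
  have theta_z: "\<theta> (z n) = c *\<^sub>C z (Suc n)" for n
    using c0 by (simp add: z_def theta.scaleC pow.into extend_in x scaleC_scaleC)
  have between: "proj n (z m (proj n v)) = z n v" if "n \<le> m" for n m v
  proof -
    define k where "k = m - n"
    have m: "m = n + k" using that by (simp add: k_def)
    have e: "extend_op V x \<in> B" by (rule extend_in[OF x])
    have "compress_op V ((\<theta> ^^ k) (extend_op V x)) = c ^ k *\<^sub>C x"
      by (simp add: compress_funpow e compress_extend funpow_eigenvector[of x A \<tau> c] x eig tau_scaleC)
    then have "proj n o\<^sub>L (\<theta> ^^ n) ((\<theta> ^^ k) (extend_op V x)) o\<^sub>L proj n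
        = (\<theta> ^^ n) (extend_op V (c ^ k *\<^sub>C x))"
      using compress_funpow_between[OF pow.into[OF e]] by simp
    also have "extend_op V (c ^ k *\<^sub>C x) = c ^ k *\<^sub>C extend_op V x"
      by (intro blinfun_eqI)
        (simp add: extend_op_def scaleC_blinfun.rep_eq bounded_ops_scaleC[OF V_bounded])
    finally have "proj n ((\<theta> ^^ m) (extend_op V x) (proj n v)) = (c ^ k *\<^sub>C (\<theta> ^^ n) (extend_op V x)) v"
      unfolding m funpow_add comp_def
      by (metis blinfun_apply_blinfun_compose pow.scaleC e)
    then have "proj n (z m (proj n v)) = (inverse c ^ m * c ^ k) *\<^sub>C (\<theta> ^^ n) (extend_op V x) v"
      by (simp add: z_def scaleC_blinfun.rep_eq bounded_ops_scaleC[OF pow.bounded[OF proj_in]] scaleC_scaleC)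
    also have "inverse c ^ m * c ^ k = inverse c ^ n"
      using c0 by (simp add: m power_add field_simps)
    finally show ?thesis
      by (simp add: z_def scaleC_blinfun.rep_eq)
  qed
  obtain w :: "'k \<Rightarrow>\<^sub>L 'k" where w: "\<And>v. (\<lambda>n. z n v) \<longlonglongrightarrow> w v" "\<And>n v. proj n (w (proj n v)) = z n v"
    by (rule increasing_projections_limit[OF proj_self proj_mono proj_tendsto norm_z between]) blast+
  have w_in: "w \<in> B"
    by (rule von_neumann_algebra_strong_limit[OF theta.vN z_in w(1)])
  have w_z: "proj n o\<^sub>L w o\<^sub>L proj n = z n" for n
    by (intro blinfun_eqI) (simp add: w(2))
  have corner: "proj n (\<theta> w (proj n v)) = proj n ((c *\<^sub>C w) (proj n v))" if "n > 0" for n v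
  proof -
    obtain k where k: "n = Suc k" using \<open>n > 0\<close> gr0_implies_Suc by blast
    have "\<theta> (proj k) = proj n"
      by (simp add: proj_def k)
    then have "proj n o\<^sub>L \<theta> w o\<^sub>L proj n = \<theta> (z k)"
      using w_z[of k] by (metis theta.compose theta.compose_in proj_in w_in)
    also have "\<dots> = c *\<^sub>C z n"
      by (simp add: theta_z k)
    finally have "proj n (\<theta> w (proj n v)) = c *\<^sub>C z n v"
      by (metis blinfun_apply_blinfun_compose scaleC_blinfun.rep_eq)
    then show ?thesis
      by (simp add: scaleC_blinfun.rep_eq bounded_ops_scaleC[OF pow.bounded[OF proj_in]] w(2))
  qed
  have lim: "(\<lambda>n. proj n (y (proj n v))) \<longlonglongrightarrow> y v" for y :: "'k \<Rightarrow>\<^sub>L 'k" and v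
    by (intro proj_tendsto_compose tendsto_intros proj_tendsto) simp
  have "\<theta> w = c *\<^sub>C w"
  proof (rule blinfun_eqI, rule LIMSEQ_unique[OF lim])
    fix v
    have "\<forall>\<^sub>F n in sequentially. proj n ((c *\<^sub>C w) (proj n v)) = proj n (\<theta> w (proj n v))"
      using eventually_gt_at_top[of 0] by eventually_elim (simp add: corner)
    then show "(\<lambda>n. proj n (\<theta> w (proj n v))) \<longlonglongrightarrow> (c *\<^sub>C w) v"
      using lim[of "c *\<^sub>C w" v] by (rule Lim_transform_eventually[rotated])
  qed
  moreover have "compress_op V w = x"
  proof -
    have "compress_op V w = compress_op V (proj 0 o\<^sub>L w o\<^sub>L proj 0)"
      by (intro blinfun_eqI) (simp add: compress_op_def proj_V adj_V_proj)
    then show ?thesis by (simp add: w_z z_0 compress_extend)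
  qed
  ultimately show thesis using w_in that by blast
qed

lemma compress_peripheral_eigenspan:
  "compress_op V ` peripheral_eigenspan B \<theta> = peripheral_eigenspan A \<tau>"
proof
  let ?SB = "{x \<in> B. \<exists>c. cmod c = 1 \<and> \<theta> x = c *\<^sub>C x}"
    and ?SA = "{x \<in> A. \<exists>c. cmod c = 1 \<and> \<tau> x = c *\<^sub>C x}"
  have zero: "compress_op V 0 = 0"
    using compress_diff[of 0 0] by simp
  show "compress_op V ` peripheral_eigenspan B \<theta> \<subseteq> peripheral_eigenspan A \<tau>"
  proof safe
    fix x assume "x \<in> peripheral_eigenspan B \<theta>"
    then have "x \<in> cspan ?SB" by (simp add: peripheral_eigenspan_def)
    then have "compress_op V x \<in> cspan ?SA"
    proof (induction rule: complex_vector.span_induct_alt)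
      case base
      show ?case by (simp add: zero complex_vector.span_zero)
    next
      case (step c s t)
      then obtain d where d: "s \<in> B" "cmod d = 1" "\<theta> s = d *\<^sub>C s" by blast
      have "\<tau> (compress_op V s) = d *\<^sub>C compress_op V s"
        using compress_funpow[OF d(1), of 1] d(3) by (simp add: compress_scaleC)
      then have "compress_op V s \<in> ?SA"
        using d by (auto intro: compress_in)
      then have "compress_op V s \<in> cspan ?SA" by (rule complex_vector.span_base)
      then show ?case
        using step by (simp add: compress_add compress_scaleC complex_vector.span_add complex_vector.span_scale)
    qed
    then show "compress_op V x \<in> peripheral_eigenspan A \<tau>"
      by (simp add: peripheral_eigenspan_def)
  qed
  show "peripheral_eigenspan A \<tau> \<subseteq> compress_op V ` peripheral_eigenspan B \<theta>"
    unfolding peripheral_eigenspan_def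
  proof (rule complex_vector.span_minimal)
    show "?SA \<subseteq> compress_op V ` cspan ?SB"
    proof
      fix x assume "x \<in> ?SA"
      then obtain c where x: "x \<in> A" "cmod c = 1" "\<tau> x = c *\<^sub>C x" by blast
      then obtain w where "w \<in> B" "\<theta> w = c *\<^sub>C w" "compress_op V w = x"
        by (rule eigenvector_lift)
      with x have "w \<in> cspan ?SB" by (intro complex_vector.span_base) auto
      then show "x \<in> compress_op V ` cspan ?SB"
        using \<open>compress_op V w = x\<close> by blast
    qed
    show "csubspace (compress_op V ` cspan ?SB)"
      unfolding complex_vector.subspace_def
    proof (intro conjI ballI allI)
      show "0 \<in> compress_op V ` cspan ?SB"
        by (rule image_eqI[where x = 0]) (simp_all add: zero complex_vector.span_zero)
    qed (auto simp flip: compress_add compress_scaleC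
        intro!: imageI complex_vector.span_add complex_vector.span_scale)
  qed
qed

text \<open>Surjectivity passes from the spans to their closures because preimages of a Cauchy sequence under
  an isometry form a Cauchy sequence.\<close>

lemma compress_peripheral_space:
  "compress_op V ` peripheral_space B \<theta> = peripheral_space A \<tau>"
proof
  have dist: "dist (compress_op V x) (compress_op V y) = dist x y"
    if "x \<in> peripheral_space B \<theta>" "y \<in> peripheral_space B \<theta>" for x y
    using that complex_vector.subspace_diff[OF theta.csubspace_peripheral_space]
    by (simp add: dist_norm norm_compress_eq flip: compress_diff)
  have lim: "(\<lambda>n. compress_op V (f n)) \<longlonglongrightarrow> compress_op V x" if "f \<longlonglongrightarrow> x" for f x
  proof -
    have "(\<lambda>n. norm (f n - x)) \<longlonglongrightarrow> 0"
      using that by (simp add: tendsto_norm_zero_iff LIM_zero_iff)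
    moreover have "\<forall>\<^sub>F n in sequentially. norm (compress_op V (f n - x)) \<le> norm (norm (f n - x)) * 1"
      by (intro always_eventually allI) (simp add: norm_compress_le)
    ultimately have "(\<lambda>n. compress_op V (f n - x)) \<longlonglongrightarrow> 0"
      by (rule tendsto_0_le)
    then show ?thesis by (simp add: compress_diff LIM_zero_iff)
  qed
  show "compress_op V ` peripheral_space B \<theta> \<subseteq> peripheral_space A \<tau>"
  proof safe
    fix x assume "x \<in> peripheral_space B \<theta>"
    then obtain f where f: "\<And>n. f n \<in> peripheral_eigenspan B \<theta>" "f \<longlonglongrightarrow> x"
      by (auto simp: peripheral_space_def closure_sequential)
    have "compress_op V (f n) \<in> peripheral_eigenspan A \<tau>" for n
      using f(1) compress_peripheral_eigenspan by blast
    then show "compress_op V x \<in> peripheral_space A \<tau>"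
      unfolding peripheral_space_def closure_sequential
      by (intro exI[of _ "\<lambda>n. compress_op V (f n)"] conjI allI lim f(2))
  qed
  show "peripheral_space A \<tau> \<subseteq> compress_op V ` peripheral_space B \<theta>"
  proof
    fix x assume "x \<in> peripheral_space A \<tau>"
    then obtain g where g: "\<And>n. g n \<in> peripheral_eigenspan A \<tau>" "g \<longlonglongrightarrow> x"
      by (auto simp: peripheral_space_def closure_sequential)
    have "\<exists>y. y \<in> peripheral_eigenspan B \<theta> \<and> g n = compress_op V y" for n
      using g(1)[of n] compress_peripheral_eigenspan by blast
    then obtain f where f: "\<And>n. f n \<in> peripheral_eigenspan B \<theta>" "\<And>n. g n = compress_op V (f n)"
      by metis
    have f_in: "f n \<in> peripheral_space B \<theta>" for n
      using f(1) closure_subset unfolding peripheral_space_def by blast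
    have "Cauchy g" using g(2) by (rule LIMSEQ_imp_Cauchy)
    then have "Cauchy f"
      unfolding Cauchy_def f(2) by (simp add: dist f_in)
    then obtain y where y: "f \<longlonglongrightarrow> y"
      using Cauchy_convergent convergent_def by blast
    then have "y \<in> peripheral_space B \<theta>"
      unfolding peripheral_space_def closure_sequential
      by (intro exI[of _ f] conjI allI f(1))
    moreover have "compress_op V y = x"
      using lim[OF y] g(2) unfolding f(2)[symmetric] by (rule LIMSEQ_unique)
    ultimately show "x \<in> compress_op V ` peripheral_space B \<theta>" by blast
  qed
qed

lemma inj_on_compress: "inj_on (compress_op V) (peripheral_space B \<theta>)"
proof (rule inj_onI)
  fix x y assume "x \<in> peripheral_space B \<theta>" "y \<in> peripheral_space B \<theta>"
    "compress_op V x = compress_op V y"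
  then show "x = y"
    using norm_compress_eq[OF complex_vector.subspace_diff[OF theta.csubspace_peripheral_space]]
    by (fastforce simp: compress_diff)
qed

lemma completely_positive_compress: "completely_positive_on S (compress_op V)"
  unfolding completely_positive_on_def clinear_on_def
proof (intro conjI ballI allI impI)
  fix n and X :: "nat \<Rightarrow> nat \<Rightarrow> 'k \<Rightarrow>\<^sub>L 'k" assume pos: "op_matrix_pos n X"
  show "op_matrix_pos n (\<lambda>i j. compress_op V (X i j))"
    unfolding op_matrix_pos_def
  proof
    fix v
    have "(\<Sum>i<n. cinner (v i) (\<Sum>j<n. compress_op V (X i j) (v j))) =
        (\<Sum>i<n. cinner (V (v i)) (\<Sum>j<n. X i j (V (v j))))"
      by (simp add: compress_op_def cinner_adj[OF V_bounded] blinfun.sum_right)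
    then show "(\<Sum>i<n. cinner (v i) (\<Sum>j<n. compress_op V (X i j) (v j))) \<in> \<real>\<^sub>\<ge>\<^sub>0"
      using pos unfolding op_matrix_pos_def by simp
  qed
qed (simp_all add: compress_add compress_scaleC)

end


section \<open>Transport of the \<open>C\<^sup>*\<close>-structure\<close>

lemma unital_cstar_algebra_transport:
  fixes T :: "'a::complex_normed_vector \<Rightarrow> 'b::complex_normed_vector"
    and prd :: "'a \<Rightarrow> 'a \<Rightarrow> 'a"
  assumes "unital_cstar_algebra S prd star"
    and bij: "bij_betw T S R" and "csubspace R" and "complete R"
    and T_add: "\<And>x y. \<lbrakk>x \<in> S; y \<in> S\<rbrakk> \<Longrightarrow> T (x + y) = T x + T y"
    and T_scaleC: "\<And>c x. x \<in> S \<Longrightarrow> T (c *\<^sub>C x) = c *\<^sub>C T x"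
    and T_norm: "\<And>x. x \<in> S \<Longrightarrow> norm (T x) = norm x"
    and T_star: "\<And>x. x \<in> S \<Longrightarrow> T (star x) = star' (T x)"
  shows "unital_cstar_algebra R
    (\<lambda>x y. T (prd (the_inv_into S T x) (the_inv_into S T y))) star'"
proof -
  interpret S: unital_cstar_algebra S prd star by fact
  let ?I = "the_inv_into S T"
  have R: "R = T ` S" and inj: "inj_on T S"
    using bij by (auto simp: bij_betw_def)
  have I_T: "?I (T x) = x" if "x \<in> S" for x
    using inj that by (rule the_inv_into_f_f)
  have add: "x + y \<in> S" if "x \<in> S" "y \<in> S" for x y
    using that by (rule complex_vector.subspace_add[OF S.subspace])
  have scale: "c *\<^sub>C x \<in> S" if "x \<in> S" for c x
    using that by (rule complex_vector.subspace_scale[OF S.subspace])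
  obtain e where e: "e \<in> S" "\<And>x. x \<in> S \<Longrightarrow> prd e x = x \<and> prd x e = x"
    using S.unit by blast
  show ?thesis
  proof
    show "csubspace R" "complete R" by fact+
    show "\<exists>e\<in>R. \<forall>x\<in>R. T (prd (?I e) (?I x)) = x \<and> T (prd (?I x) (?I e)) = x"
      unfolding R by (intro bexI[of _ "T e"]) (auto simp: I_T e)
  qed (unfold R; safe; simp add: I_T add scale S.mult_closed S.mult_assoc S.mult_add_left
      S.mult_add_right S.mult_scaleC_left S.mult_scaleC_right S.star_closed S.star_star S.star_add
      S.star_scaleC S.star_mult S.norm_mult_le S.cstar_identity T_norm
      flip: T_add T_scaleC T_star)+
qed

theorem theorem2p3:
  fixes A :: "('h::complex_hilbert_space \<Rightarrow>\<^sub>L 'h) set"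
    and \<tau> :: "'h \<Rightarrow>\<^sub>L 'h \<Rightarrow> 'h \<Rightarrow>\<^sub>L 'h"
    and V :: "'h \<Rightarrow>\<^sub>L 'k::complex_hilbert_space"
    and B :: "('k \<Rightarrow>\<^sub>L 'k) set"
    and \<theta> :: "'k \<Rightarrow>\<^sub>L 'k \<Rightarrow> 'k \<Rightarrow>\<^sub>L 'k"
    and T :: "'k \<Rightarrow>\<^sub>L 'k \<Rightarrow> 'h \<Rightarrow>\<^sub>L 'h"
  assumes sep_H: "separable_space (euclidean :: 'h topology)"
    and sep_K: "separable_space (euclidean :: 'k topology)"
    and vN_A: "von_neumann_algebra A"
    and ucp: "normal_ucp_map A \<tau>"
    and dil: "minimal_dilation A \<tau> V B \<theta>"
  defines "T \<equiv> compress_op V"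
  shows "unital_cstar_algebra (peripheral_space B \<theta>) (o\<^sub>L) adj
    \<and> completely_positive_on (peripheral_space B \<theta>) T
    \<and> (\<forall>z \<in> peripheral_space B \<theta>. norm (T z) = norm z)
    \<and> bij_betw T (peripheral_space B \<theta>) (peripheral_space A \<tau>)
    \<and> unital_cstar_algebra (peripheral_space A \<tau>)
        (\<lambda>x y. T (the_inv_into (peripheral_space B \<theta>) T x o\<^sub>L the_inv_into (peripheral_space B \<theta>) T y))
        adj
    \<and> completely_isometric_on (peripheral_space B \<theta>) T"
proof -
  interpret dilation A \<tau> V B \<theta>
    using vN_A ucp dil by unfold_locales
  have bij: "bij_betw T (peripheral_space B \<theta>) (peripheral_space A \<tau>)"
    unfolding T_def bij_betw_def using inj_on_compress compress_peripheral_space by blast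
  have bounded: "z \<in> bounded_ops" if "z \<in> peripheral_space B \<theta>" for z
    using that theta.peripheral_space_subset theta.bounded by blast
  have "unital_cstar_algebra (peripheral_space A \<tau>)
      (\<lambda>x y. T (the_inv_into (peripheral_space B \<theta>) T x o\<^sub>L the_inv_into (peripheral_space B \<theta>) T y)) adj"
  proof (rule unital_cstar_algebra_transport[OF theta.unital_cstar_algebra_peripheral_space bij])
    show "csubspace (peripheral_space A \<tau>)"
      unfolding peripheral_space_def peripheral_eigenspan_def
      by (rule csubspace_closure[OF complex_vector.subspace_span])
    show "complete (peripheral_space A \<tau>)"
      by (simp add: complete_eq_closed peripheral_space_def)
  qed (simp_all add: T_def compress_add compress_scaleC norm_compress_eq compress_adj bounded)
  moreover have "completely_isometric_on (peripheral_space B \<theta>) T"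
    unfolding completely_isometric_on_def clinear_on_def T_def
    by (simp add: compress_add compress_scaleC op_matrix_norm_compress_eq)
  ultimately show ?thesis
    using theta.unital_cstar_algebra_peripheral_space completely_positive_compress
      norm_compress_eq bij
    unfolding T_def by blast
qed

end
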